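(* The Cholesky-Vinberg path is generally not a geodesic for the Levi-Civita connection of the canonical Hessian metric $g^{\mathrm{can}}$ on $\Omega$; that is, there exist $x,y\in\Omega$ such that the curve $t\mapsto\gamma^{\mathrm{cv}}_{x,y}(t)$, $0\le t\le 1$, does not satisfy the geodesic equation $\nabla_{\dot\gamma}\dot\gamma=0$, where $\nabla$ is the Levi-Civita connection of $g^{\mathrm{can}}$.
   Context: Let $V\subset \mathrm{Sym}(3,\mathbb{R})$ be the 5-dimensional space of matrices $x=\begin{pmatrix} x_1 & 0 & x_4 \\ 0 & x_2 & x_5 \\ x_4 & x_5 & x_3 \end{pmatrix}$, $x_i\in\mathbb{R}$, and let $\Omega\subset V$ be the open cone of positive definite matrices in $V$. Let $H$ be the group of real lower triangular $3\times 3$ matrices with positive diagonal entries and zero $(2,1)$ entry. The map $\Phi:H\to\Omega$, $\Phi(T)=TT^{\top}$, is a diffeomorphism; $T_x:=\Phi^{-1}(x)\in H$ for $x\in\Omega$. For $T\in H$ and $t\in\mathbb{R}$, $T^t:=\exp(t\log T)\in H$, with the principal matrix logarithm. The Cholesky-Vinberg path is $\gamma^{\mathrm{cv}}_{x,y}(t):=\Phi\bigl(T_x(T_x^{-1}T_y)^t\bigr)$, $0\le t\le1$. The canonical Hessian metric is the Riemannian metric on $\Omega$ (with $T_x\Omega\simeq V$) $$g^{\mathrm{can}}_x(u,v)=D_uD_v\log\varphi_\Omega(x)=-\frac12\left(\frac{u_1v_1}{x_1^2}+\frac{u_2v_2}{x_2^2}\right)+2\,\mathrm{tr}(x^{-1}ux^{-1}v),$$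 where $\varphi_\Omega(x)=c\,x_1^{1/2}x_2^{1/2}(\det x)^{-2}$, $c>0$, is the Koszul-Vinberg characteristic function of $\Omega$. *)

theory Defs
  imports "HOL-Analysis.Analysis"
begin

section \<open>Levi-Civita connections on relatively open subsets of a linear subspace\<close>

text \<open>
  Throughout, \<open>W\<close> is a linear subspace of a Euclidean space and \<open>U\<close> is a subset of \<open>W\<close> that is
  open in \<open>W\<close>, so that \<open>U\<close> is a manifold all of whose tangent spaces are \<open>W\<close>.
\<close>

definition dir_deriv :: "'a::real_normed_vector \<Rightarrow> ('a \<Rightarrow> 'b::real_normed_vector) \<Rightarrow> 'a \<Rightarrow> 'b" where
  "dir_deriv u f x = vector_derivative (\<lambda>s. f (x + s *\<^sub>R u)) (at 0)"

primrec times_diff_on ::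
  "nat \<Rightarrow> 'a::real_normed_vector set \<Rightarrow> 'a set \<Rightarrow> ('a \<Rightarrow> 'b::real_normed_vector) \<Rightarrow> bool" where
  "times_diff_on 0 W U f \<longleftrightarrow> continuous_on U f"
| "times_diff_on (Suc k) W U f \<longleftrightarrow>
     f differentiable_on U \<and> (\<forall>w\<in>W. times_diff_on k W U (dir_deriv w f))"

definition smooth_fun_on ::
  "'a::real_normed_vector set \<Rightarrow> 'a set \<Rightarrow> ('a \<Rightarrow> 'b::real_normed_vector) \<Rightarrow> bool" where
  "smooth_fun_on W U f \<longleftrightarrow> (\<forall>k. times_diff_on k W U f)"

definition smooth_field :: "'a::real_normed_vector set \<Rightarrow> 'a set \<Rightarrow> ('a \<Rightarrow> 'a) \<Rightarrow> bool" where
  "smooth_field W U X \<longleftrightarrow> smooth_fun_on W U X \<and> (\<forall>x\<in>U. X x \<in> W)"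

definition lie_bracket :: "('a::real_normed_vector \<Rightarrow> 'a) \<Rightarrow> ('a \<Rightarrow> 'a) \<Rightarrow> 'a \<Rightarrow> 'a" where
  "lie_bracket X Y x = dir_deriv (X x) Y x - dir_deriv (Y x) X x"

type_synonym 'a covariant_derivative = "('a \<Rightarrow> 'a) \<Rightarrow> ('a \<Rightarrow> 'a) \<Rightarrow> 'a \<Rightarrow> 'a"

definition affine_connection ::
  "'a::real_normed_vector set \<Rightarrow> 'a set \<Rightarrow> 'a covariant_derivative \<Rightarrow> bool" where
  "affine_connection W U nabla \<longleftrightarrow>
     (\<forall>X Y. smooth_field W U X \<longrightarrow> smooth_field W U Y \<longrightarrow> (\<forall>x\<in>U. nabla X Y x \<in> W)) \<and>
     (\<forall>X X' Y. smooth_field W U X \<longrightarrow> smooth_field W U X' \<longrightarrow> smooth_field W U Y \<longrightarrow>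
        (\<forall>x\<in>U. nabla (\<lambda>z. X z + X' z) Y x = nabla X Y x + nabla X' Y x)) \<and>
     (\<forall>f X Y. smooth_fun_on W U f \<longrightarrow> smooth_field W U X \<longrightarrow> smooth_field W U Y \<longrightarrow>
        (\<forall>x\<in>U. nabla (\<lambda>z. f z *\<^sub>R X z) Y x = f x *\<^sub>R nabla X Y x)) \<and>
     (\<forall>X Y Y'. smooth_field W U X \<longrightarrow> smooth_field W U Y \<longrightarrow> smooth_field W U Y' \<longrightarrow>
        (\<forall>x\<in>U. nabla X (\<lambda>z. Y z + Y' z) x = nabla X Y x + nabla X Y' x)) \<and>
     (\<forall>f X Y. smooth_fun_on W U f \<longrightarrow> smooth_field W U X \<longrightarrow> smooth_field W U Y \<longrightarrow>
        (\<forall>x\<in>U. nabla X (\<lambda>z. f z *\<^sub>R Y z) x = dir_deriv (X x) f x *\<^sub>R Y x + f x *\<^sub>R nabla X Y x))"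

definition torsion_free ::
  "'a::real_normed_vector set \<Rightarrow> 'a set \<Rightarrow> 'a covariant_derivative \<Rightarrow> bool" where
  "torsion_free W U nabla \<longleftrightarrow>
     (\<forall>X Y. smooth_field W U X \<longrightarrow> smooth_field W U Y \<longrightarrow>
        (\<forall>x\<in>U. nabla X Y x - nabla Y X x = lie_bracket X Y x))"

definition metric_compatible ::
  "'a::real_normed_vector set \<Rightarrow> 'a set \<Rightarrow> ('a \<Rightarrow> 'a \<Rightarrow> 'a \<Rightarrow> real) \<Rightarrow> 'a covariant_derivative \<Rightarrow> bool" where
  "metric_compatible W U g nabla \<longleftrightarrow>
     (\<forall>X Y Z. smooth_field W U X \<longrightarrow> smooth_field W U Y \<longrightarrow> smooth_field W U Z \<longrightarrow>
        (\<forall>x\<in>U. dir_deriv (X x) (\<lambda>z. g z (Y z) (Z z)) x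
               = g x (nabla X Y x) (Z x) + g x (Y x) (nabla X Z x)))"

text \<open>
  The last clause only fixes the junk values of \<open>nabla\<close> (HOL functions are total), so that the
  description is unique. Smoothness of \<open>nabla X Y\<close> is not demanded: by the Koszul formula, torsion
  freeness and compatibility with \<open>g\<close> already determine \<open>nabla X Y\<close> on \<open>U\<close>, so for a smooth metric the
  usual (smooth) Levi-Civita connection is the only solution.
\<close>

definition levi_civita ::
  "'a::real_normed_vector set \<Rightarrow> 'a set \<Rightarrow> ('a \<Rightarrow> 'a \<Rightarrow> 'a \<Rightarrow> real) \<Rightarrow> 'a covariant_derivative" where
  "levi_civita W U g = (THE nabla. affine_connection W U nabla \<and> torsion_free W U nabla \<and> metric_compatible W U g nabla \<and>
     (\<forall>X Y x. \<not> (smooth_field W U X \<and> smooth_field W U Y \<and> x \<in> U) \<longrightarrow> nabla X Y x = 0))"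

text \<open>
  Covariant derivative at time \<open>t\<close> of a vector field \<open>Y\<close> along a curve \<open>\<gamma>\<close> defined on \<open>I\<close>. In the
  global frame of constant vector fields \<open>E\<^sub>i\<close>, write \<open>Y = (\<Sum>i. Y\<^sub>i E\<^sub>i)\<close>; the Leibniz rule gives
  \<open>(\<Sum>i. Y\<^sub>i'(t) E\<^sub>i + Y\<^sub>i(t) nabla\<^bsub>\<gamma>'(t)\<^esub> E\<^sub>i)\<close>, which is the expression below (constant fields carry
  the tangent vectors \<open>\<gamma>'(t)\<close> and \<open>Y(t)\<close>).
\<close>

definition covariant_deriv_along ::
  "'a::real_normed_vector covariant_derivative \<Rightarrow> real set \<Rightarrow> (real \<Rightarrow> 'a) \<Rightarrow> (real \<Rightarrow> 'a) \<Rightarrow> real \<Rightarrow> 'a" where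
  "covariant_deriv_along nabla I \<gamma> Y t =
     vector_derivative Y (at t within I)
     + nabla (\<lambda>_. vector_derivative \<gamma> (at t within I)) (\<lambda>_. Y t) (\<gamma> t)"

definition satisfies_geodesic_equation ::
  "'a::real_normed_vector covariant_derivative \<Rightarrow> real set \<Rightarrow> (real \<Rightarrow> 'a) \<Rightarrow> bool" where
  "satisfies_geodesic_equation nabla I \<gamma> \<longleftrightarrow>
     (\<forall>t\<in>I. covariant_deriv_along nabla I \<gamma> (\<lambda>s. vector_derivative \<gamma> (at s within I)) t = 0)"


section \<open>Matrix exponential, principal logarithm and real powers\<close>

definition matrix_exp :: "real^'n^'n \<Rightarrow> real^'n^'n" where
  "matrix_exp A = (\<Sum>k. (1 / fact k) *\<^sub>R ((\<lambda>B. A ** B) ^^ k) (mat 1))"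

definition complex_eigenvalue :: "real^'n^'n \<Rightarrow> complex \<Rightarrow> bool" where
  "complex_eigenvalue A z \<longleftrightarrow> (\<exists>v. v \<noteq> 0 \<and> map_matrix complex_of_real A *v v = z *s v)"

text \<open>The principal logarithm is the one with spectrum in the open strip \<open>\<bar>Im z\<bar> < pi\<close>.\<close>

definition matrix_log :: "real^'n^'n \<Rightarrow> real^'n^'n" where
  "matrix_log T = (THE L. matrix_exp L = T \<and> (\<forall>z. complex_eigenvalue L z \<longrightarrow> \<bar>Im z\<bar> < pi))"

definition matrix_rpow :: "real^'n^'n \<Rightarrow> real \<Rightarrow> real^'n^'n" where
  "matrix_rpow T t = matrix_exp (t *\<^sub>R matrix_log T)"


section \<open>The cone and the Cholesky-Vinberg path\<close>

text \<open>In coordinates, \<open>x\<^sub>1, x\<^sub>2, x\<^sub>3\<close> is the diagonal, \<open>x\<^sub>4 = x$1$3\<close> and \<open>x\<^sub>5 = x$2$3\<close>.\<close>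

definition Vsp :: "(real^3^3) set" where
  "Vsp = {x. transpose x = x \<and> x$1$2 = 0}"

definition \<Omega> :: "(real^3^3) set" where
  "\<Omega> = {x \<in> Vsp. \<forall>v. v \<noteq> 0 \<longrightarrow> 0 < v \<bullet> (x *v v)}"

definition Hgrp :: "(real^3^3) set" where
  "Hgrp = {T. T$1$2 = 0 \<and> T$1$3 = 0 \<and> T$2$3 = 0 \<and> T$2$1 = 0 \<and> (\<forall>i. 0 < T$i$i)}"

definition \<Phi> :: "real^3^3 \<Rightarrow> real^3^3" where
  "\<Phi> T = T ** transpose T"

definition chol :: "real^3^3 \<Rightarrow> real^3^3" where
  "chol x = the_inv_into Hgrp \<Phi> x"

definition cv_path :: "real^3^3 \<Rightarrow> real^3^3 \<Rightarrow> real \<Rightarrow> real^3^3" where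
  "cv_path x y t = \<Phi> (chol x ** matrix_rpow (matrix_inv (chol x) ** chol y) t)"


section \<open>The canonical Hessian metric\<close>

text \<open>
  \<open>char_fun c\<close> is the Koszul-Vinberg characteristic function \<open>\<integral> exp (- \<langle>x, \<xi>\<rangle>) d\<xi>\<close> over the dual
  cone in its closed form; the constant \<open>c > 0\<close> depends on the normalisation of the measure.
\<close>

definition char_fun :: "real \<Rightarrow> real^3^3 \<Rightarrow> real" where
  "char_fun c x = c * (x$1$1) powr (1/2) * (x$2$2) powr (1/2) * (det x) powr (-2)"

definition g_can :: "real \<Rightarrow> real^3^3 \<Rightarrow> real^3^3 \<Rightarrow> real^3^3 \<Rightarrow> real" where
  "g_can c x u v = dir_deriv u (dir_deriv v (\<lambda>z. ln (char_fun c z))) x"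

text \<open>The remaining facts culminate in \<open>g_can_eq\<close>, the closed form of the metric.\<close>

lemma V_entries:
  assumes "x \<in> Vsp"
  shows "x$1$2 = 0" "x$2$1 = 0" "x$3$1 = x$1$3" "x$3$2 = x$2$3"
proof -
  have tr: "transpose x = x" and x12: "x$1$2 = 0"
    using assms by (auto simp: Vsp_def)
  have sym: "x$j$i = x$i$j" for i j
  proof -
    have "x$j$i = transpose x$i$j" by (simp add: transpose_def)
    then show ?thesis by (simp only: tr)
  qed
  show "x$1$2 = 0" "x$2$1 = 0" "x$3$1 = x$1$3" "x$3$2 = x$2$3"
    using sym[of 1 2] sym[of 1 3] sym[of 2 3] x12 by auto
qed

lemma \<Omega>_pos:
  assumes "x \<in> \<Omega>"
  shows "0 < x$1$1" "0 < x$2$2" "0 < det x"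
proof -
  have pd: "0 < v \<bullet> (x *v v)" if "v \<noteq> 0" for v
    using assms that by (auto simp: \<Omega>_def)
  have "x \<in> Vsp"
    using assms by (simp add: \<Omega>_def)
  note s = V_entries[OF this]
  show p1: "0 < x$1$1"
    using pd[of "vector [1,0,0]"]
    by (auto simp: vec_eq_iff forall_3 inner_vec_def sum_3 matrix_vector_mult_def vector_3)
  show p2: "0 < x$2$2"
    using pd[of "vector [0,1,0]"]
    by (auto simp: vec_eq_iff forall_3 inner_vec_def sum_3 matrix_vector_mult_def vector_3)
  have "0 < x$3$3 - (x$1$3)\<^sup>2 / x$1$1 - (x$2$3)\<^sup>2 / x$2$2"
    using pd[of "vector [- x$1$3 / x$1$1, - x$2$3 / x$2$2, 1]"] p1 p2
    by (auto simp: vec_eq_iff forall_3 inner_vec_def sum_3 matrix_vector_mult_def vector_3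
        s field_simps power2_eq_square)
  then have "0 < x$1$1 * x$2$2 * (x$3$3 - (x$1$3)\<^sup>2 / x$1$1 - (x$2$3)\<^sup>2 / x$2$2)"
    using p1 p2 by simp
  also have "\<dots> = det x"
    using p1 p2 by (simp add: det_3 s field_simps power2_eq_square)
  finally show "0 < det x" .
qed

text \<open>The determinant on \<open>Vsp\<close> and its first and second directional derivatives.\<close>

definition detV :: "real^3^3 \<Rightarrow> real" where
  "detV z = z$1$1 * z$2$2 * z$3$3 - z$1$1 * (z$2$3)\<^sup>2 - z$2$2 * (z$1$3)\<^sup>2"

definition detV1 :: "real^3^3 \<Rightarrow> real^3^3 \<Rightarrow> real" where
  "detV1 v z = v$1$1 * z$2$2 * z$3$3 + z$1$1 * v$2$2 * z$3$3 + z$1$1 * z$2$2 * v$3$3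
    - v$1$1 * (z$2$3)\<^sup>2 - 2 * z$1$1 * z$2$3 * v$2$3 - v$2$2 * (z$1$3)\<^sup>2 - 2 * z$2$2 * z$1$3 * v$1$3"

definition detV2 :: "real^3^3 \<Rightarrow> real^3^3 \<Rightarrow> real^3^3 \<Rightarrow> real" where
  "detV2 u v z = v$1$1 * u$2$2 * z$3$3 + v$1$1 * z$2$2 * u$3$3
     + u$1$1 * v$2$2 * z$3$3 + z$1$1 * v$2$2 * u$3$3
     + u$1$1 * z$2$2 * v$3$3 + z$1$1 * u$2$2 * v$3$3
    - 2 * v$1$1 * z$2$3 * u$2$3 - 2 * u$1$1 * z$2$3 * v$2$3 - 2 * z$1$1 * u$2$3 * v$2$3
    - 2 * v$2$2 * z$1$3 * u$1$3 - 2 * u$2$2 * z$1$3 * v$1$3 - 2 * z$2$2 * u$1$3 * v$1$3"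

lemma det_V: "z \<in> Vsp \<Longrightarrow> det z = detV z"
  by (simp add: det_3 V_entries detV_def power2_eq_square algebra_simps)

lemma V_line: "x \<in> Vsp \<Longrightarrow> u \<in> Vsp \<Longrightarrow> x + s *\<^sub>R u \<in> Vsp"
  by (simp add: Vsp_def transpose_def vec_eq_iff)

lemma line_pos:
  assumes "x \<in> Vsp" "u \<in> Vsp" "0 < x$1$1" "0 < x$2$2" "0 < det x"
  shows "\<forall>\<^sub>F s in nhds (0::real). 0 < (x + s *\<^sub>R u)$1$1 \<and> 0 < (x + s *\<^sub>R u)$2$2 \<and> 0 < det (x + s *\<^sub>R u)"
proof -
  have d: "det (x + s *\<^sub>R u) = detV (x + s *\<^sub>R u)" for s
    using det_V V_line assms by blast
  have "isCont (\<lambda>s. (x + s *\<^sub>R u)$1$1) 0" "isCont (\<lambda>s. (x + s *\<^sub>R u)$2$2) 0"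
    "isCont (\<lambda>s. detV (x + s *\<^sub>R u)) 0"
    unfolding detV_def by (auto intro!: continuous_intros)
  moreover have "\<forall>\<^sub>F s in nhds 0. 0 < f s" if "isCont f 0" "0 < f 0" for f :: "real \<Rightarrow> real"
    using that order_tendstoD(1)[of f "f 0" "nhds 0" 0]
    by (simp add: isCont_def tendsto_at_iff_tendsto_nhds)
  moreover have "0 < detV x" using assms det_V by metis
  ultimately show ?thesis
    unfolding d by (intro eventually_conj) (use assms in simp_all)
qed

lemma DERIV_detV: "((\<lambda>s. detV (x + s *\<^sub>R u)) has_real_derivative detV1 u x) (at 0)"
  unfolding detV_def detV1_def
  by (auto intro!: derivative_eq_intros simp: algebra_simps power2_eq_square)

lemma DERIV_detV1: "((\<lambda>s. detV1 v (x + s *\<^sub>R u)) has_real_derivative detV2 u v x) (at 0)"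
  unfolding detV1_def detV2_def
  by (auto intro!: derivative_eq_intros simp: algebra_simps power2_eq_square)

lemma dir_deriv_ln_char_fun:
  assumes "0 < c" "x \<in> Vsp" "v \<in> Vsp" "0 < x$1$1" "0 < x$2$2" "0 < det x"
  shows "dir_deriv v (\<lambda>z. ln (char_fun c z)) x
    = (v$1$1 / x$1$1 + v$2$2 / x$2$2) / 2 - 2 * detV1 v x / detV x"
proof -
  let ?h = "\<lambda>s. ln c + ln ((x + s *\<^sub>R v)$1$1) / 2 + ln ((x + s *\<^sub>R v)$2$2) / 2 - 2 * ln (detV (x + s *\<^sub>R v))"
  have p: "0 < detV x" using assms det_V by metis
  have "\<forall>\<^sub>F s in nhds 0. ln (char_fun c (x + s *\<^sub>R v)) = ?h s"
    using line_pos[OF assms(2,3,4,5,6)]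
    by eventually_elim
      (use assms in \<open>simp add: char_fun_def ln_mult ln_powr flip: det_V[OF V_line[OF assms(2,3)]]\<close>)
  moreover have "(?h has_real_derivative (v$1$1 / x$1$1 + v$2$2 / x$2$2) / 2 - 2 * detV1 v x / detV x) (at 0)"
    using assms p by (auto intro!: derivative_eq_intros DERIV_detV simp: field_simps)
  ultimately have "((\<lambda>s. ln (char_fun c (x + s *\<^sub>R v))) has_real_derivative
     (v$1$1 / x$1$1 + v$2$2 / x$2$2) / 2 - 2 * detV1 v x / detV x) (at 0)"
    by (subst DERIV_cong_ev[OF refl _ refl]) auto
  then show ?thesis
    unfolding dir_deriv_def
    by (simp add: has_real_derivative_iff_has_vector_derivative vector_derivative_at)
qed

definition adjV :: "real^3^3 \<Rightarrow> real^3^3" where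
  "adjV x = vector [
     vector [x$2$2 * x$3$3 - (x$2$3)\<^sup>2, x$1$3 * x$2$3, - x$2$2 * x$1$3],
     vector [x$1$3 * x$2$3, x$1$1 * x$3$3 - (x$1$3)\<^sup>2, - x$1$1 * x$2$3],
     vector [- x$2$2 * x$1$3, - x$1$1 * x$2$3, x$1$1 * x$2$2]]"

lemma matrix_inv_V:
  assumes "x \<in> Vsp" "0 < det x"
  shows "matrix_inv x = (1 / detV x) *\<^sub>R adjV x"
proof -
  have p: "0 < detV x" using assms det_V by metis
  have 1: "x ** adjV x = detV x *\<^sub>R mat 1"
    by (simp add: vec_eq_iff forall_3 matrix_matrix_mult_def sum_3 vector_3 mat_def V_entries[OF assms(1)]
        adjV_def detV_def power2_eq_square algebra_simps)
  have "x ** ((1 / detV x) *\<^sub>R adjV x) = (1 / detV x) *\<^sub>R (x ** adjV x)"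
    by (simp add: vec_eq_iff matrix_matrix_mult_def sum_divide_distrib)
  also have "\<dots> = mat 1"
    using p by (simp add: 1)
  finally have 2: "x ** ((1 / detV x) *\<^sub>R adjV x) = mat 1" .
  then have "matrix_inv x ** x = mat 1"
    unfolding matrix_inv_def
    using someI[of "\<lambda>B. x ** B = mat 1 \<and> B ** x = mat 1" "(1 / detV x) *\<^sub>R adjV x"]
    by (simp add: matrix_left_right_inverse)
  with 2 show ?thesis
    by (metis matrix_mul_assoc matrix_mul_lid matrix_mul_rid)
qed

lemma trace_adjV:
  assumes x: "x \<in> Vsp" and u: "u \<in> Vsp" and v: "v \<in> Vsp"
  shows "trace ((adjV x ** u) ** (adjV x ** v)) = detV1 u x * detV1 v x - detV x * detV2 u v x"
proof -
  have e: "trace (P ** Q) = P$1$1 * Q$1$1 + P$1$2 * Q$2$1 + P$1$3 * Q$3$1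
     + P$2$1 * Q$1$2 + P$2$2 * Q$2$2 + P$2$3 * Q$3$2
     + P$3$1 * Q$1$3 + P$3$2 * Q$2$3 + P$3$3 * Q$3$3" for P Q :: "real^3^3"
    by (simp add: trace_def matrix_matrix_mult_def sum_3)
  have m: "(adjV x ** w)$i$j = adjV x$i$1 * w$1$j + adjV x$i$2 * w$2$j + adjV x$i$3 * w$3$j" for w :: "real^3^3" and i j
    by (simp add: matrix_matrix_mult_def sum_3)
  show ?thesis
    unfolding e m
    unfolding adjV_def vector_3 V_entries[OF u] V_entries[OF v] detV_def detV1_def detV2_def
    by algebra
qed

lemma g_can_eq:
  assumes c: "0 < c" and x: "x \<in> \<Omega>" and u: "u \<in> Vsp" and v: "v \<in> Vsp"
  shows "g_can c x u v =
    - 1/2 * (u$1$1 * v$1$1 / (x$1$1)\<^sup>2 + u$2$2 * v$2$2 / (x$2$2)\<^sup>2)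
    + 2 * trace (matrix_inv x ** u ** matrix_inv x ** v)"
proof -
  note pos = \<Omega>_pos[OF x]
  have xV: "x \<in> Vsp" using x by (simp add: \<Omega>_def)
  have p: "0 < detV x" using pos det_V xV by metis
  let ?h = "\<lambda>s. (v$1$1 / (x + s *\<^sub>R u)$1$1 + v$2$2 / (x + s *\<^sub>R u)$2$2) / 2
     - 2 * detV1 v (x + s *\<^sub>R u) / detV (x + s *\<^sub>R u)"
  let ?D = "- (1/2) * (u$1$1 * v$1$1 / (x$1$1)\<^sup>2 + u$2$2 * v$2$2 / (x$2$2)\<^sup>2)
    + 2 * ((detV1 u x * detV1 v x - detV x * detV2 u v x) / (detV x)\<^sup>2)"
  have "\<forall>\<^sub>F s in nhds 0. dir_deriv v (\<lambda>z. ln (char_fun c z)) (x + s *\<^sub>R u) = ?h s"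
    using line_pos[OF xV u pos]
    by eventually_elim (rule dir_deriv_ln_char_fun, use c V_line[OF xV u] v in auto)
  moreover have "(?h has_real_derivative ?D) (at 0)"
    using pos p
    by (auto intro!: derivative_eq_intros DERIV_detV DERIV_detV1 simp: power2_eq_square)
      (simp add: field_simps)
  ultimately have "((\<lambda>s. dir_deriv v (\<lambda>z. ln (char_fun c z)) (x + s *\<^sub>R u)) has_real_derivative ?D) (at 0)"
    by (subst DERIV_cong_ev[OF refl _ refl]) auto
  then have "g_can c x u v = ?D"
    unfolding g_can_def
    by (subst dir_deriv_def) (simp add: has_real_derivative_iff_has_vector_derivative vector_derivative_at)
  also have "(detV1 u x * detV1 v x - detV x * detV2 u v x) / (detV x)\<^sup>2
     = trace ((matrix_inv x ** u) ** (matrix_inv x ** v))"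
  proof -
    have "(k *\<^sub>R A) ** B = k *\<^sub>R (A ** B)" "A ** (k *\<^sub>R B) = k *\<^sub>R (A ** B)" "trace (k *\<^sub>R A) = k * trace A"
      for k and A B :: "real^3^3"
      by (simp_all add: vec_eq_iff matrix_matrix_mult_def trace_def sum_distrib_left mult_ac)
    then show ?thesis
      by (simp add: matrix_inv_V[OF xV pos(3)] trace_adjV[OF xV u v] power2_eq_square)
  qed
  also have "(matrix_inv x ** u) ** (matrix_inv x ** v) = matrix_inv x ** u ** matrix_inv x ** v"
    by (simp add: matrix_mul_assoc)
  finally show ?thesis by simp
qed

end

theory Submission
  imports Defs
begin

text \<open>
  Take \<open>x\<close> the identity and \<open>y = T T\<^sup>T\<close> with \<open>T = 1 + N\<close>, where \<open>N = E31\<close> satisfies \<open>N N = 0\<close>. Then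
  \<open>log T = N\<close> and \<open>T^t = 1 + t N\<close>, so with \<open>u = N + N\<^sup>T\<close> and \<open>w = N N\<^sup>T\<close> the path is the polynomial
  \<open>1 + t u + t\<^sup>2 w\<close>. At \<open>t = 0\<close> the geodesic equation reads \<open>2 w + nabla\<^bsub>u\<^esub> u = 0\<close>; pairing it with \<open>w\<close>
  gives \<open>4\<close> from the first term, whereas the Koszul formula gives \<open>-2\<close> for the second.
\<close>

section \<open>The Levi-Civita connection of a metric on a relatively open set\<close>

text \<open>\<open>levi_civita\<close> is a definite description, so it has no usable value until
  existence and uniqueness are both proved; this is why a general connection theory precedes a
  computation at a single point. The metric is controlled only at points of \<open>U\<close> and on
  vectors of \<open>W\<close>, whereas coordinate bases belong to the ambient space. A linear
  projection onto \<open>W\<close> mediates between the two, and relative openness of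
  \<open>U\<close> makes directional derivatives insensitive to values off \<open>U\<close>. The
  closed form of the metric, with an inverse matrix and a negative summand, displays neither
  positivity nor differentiability. Completing squares with the Schur complement displays both, and
  turns the metric coefficients along the two lines needed at the end into rational functions of one
  variable. The test vector \<open>w\<close> is half of the acceleration of the path at 0.\<close>

locale subspace_metric =
  fixes W U :: "'a::euclidean_space set" and g :: "'a \<Rightarrow> 'a \<Rightarrow> 'a \<Rightarrow> real"
  assumes subspace_W: "subspace W"
    and openin_U: "openin (top_of_set W) U"
    and g_add: "\<lbrakk>x \<in> U; u \<in> W; v \<in> W; w \<in> W\<rbrakk> \<Longrightarrow> g x (u + v) w = g x u w + g x v w"
    and g_scale: "\<lbrakk>x \<in> U; u \<in> W; w \<in> W\<rbrakk> \<Longrightarrow> g x (r *\<^sub>R u) w = r * g x u w"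
    and g_sym: "\<lbrakk>x \<in> U; u \<in> W; w \<in> W\<rbrakk> \<Longrightarrow> g x u w = g x w u"
    and g_pos: "\<lbrakk>x \<in> U; u \<in> W; u \<noteq> 0\<rbrakk> \<Longrightarrow> 0 < g x u u"
    and g_diff: "\<lbrakk>v \<in> W; w \<in> W\<rbrakk> \<Longrightarrow> (\<lambda>z. g z v w) differentiable_on U"
begin

section \<open>Directional derivatives on a relatively open set\<close>

lemma U_subset: "U \<subseteq> W"
  using openin_U openin_imp_subset by blast

lemmas W_add = subspace_add[OF subspace_W]
  and W_scale = subspace_scale[OF subspace_W]
  and W_diff = subspace_diff[OF subspace_W]
  and W_zero = subspace_0[OF subspace_W]

text \<open>Relative openness keeps the line \<open>x + s *\<^sub>R u\<close> in \<open>U\<close>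
  for \<open>s\<close> in an open set \<open>S\<close> around 0. There the chain rule applies to the
  derivative within \<open>U\<close>, and the derivative within \<open>S\<close> at 0 is the full
  one.\<close>

lemma has_vector_derivative_line:
  assumes "(f has_derivative f') (at x within U)" "x \<in> U" "u \<in> W"
  shows "((\<lambda>s. f (x + s *\<^sub>R u)) has_vector_derivative f' u) (at 0)"
proof -
  obtain T where T: "open T" "U = W \<inter> T"
    using openin_U by (auto simp: openin_open)
  define S where "S = {s. x + s *\<^sub>R u \<in> T}"
  have "open S"
    unfolding S_def using T(1)
    using open_vimage[OF T(1), of "\<lambda>s. x + s *\<^sub>R u"] by (simp add: vimage_def continuous_intros)
  have S: "0 \<in> S" "(\<lambda>s. x + s *\<^sub>R u) ` S \<subseteq> U"
    using assms T U_subset W_add W_scale by (auto simp: S_def)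
  have "((\<lambda>s. x + s *\<^sub>R u) has_derivative (\<lambda>s. s *\<^sub>R u)) (at 0 within S)"
    by (auto intro!: derivative_eq_intros)
  then have "((\<lambda>s. f (x + s *\<^sub>R u)) has_derivative (\<lambda>s. f' (s *\<^sub>R u))) (at 0 within S)"
    by (rule has_derivative_in_compose) (use assms(1) S(2) in \<open>auto intro: has_derivative_subset\<close>)
  moreover have "f' (s *\<^sub>R u) = s *\<^sub>R f' u" for s
    using has_derivative_linear[OF assms(1)] by (simp add: linear_cmul)
  ultimately show ?thesis
    unfolding has_vector_derivative_def at_within_open[OF S(1) \<open>open S\<close>] by simp
qed

text \<open>Linearity in the direction is inherited from one derivative within \<open>U\<close>;
  \<open>f\<close> constrains that derivative only along \<open>W\<close>, hence the restriction on
  \<open>u\<close>.\<close>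

lemma dir_deriv_linear:
  fixes f :: "'a \<Rightarrow> 'b::real_normed_vector"
  assumes "f differentiable_on U" "x \<in> U"
  obtains f' where "linear f'" "\<And>u. u \<in> W \<Longrightarrow> dir_deriv u f x = f' u"
    "\<And>u. u \<in> W \<Longrightarrow> ((\<lambda>s. f (x + s *\<^sub>R u)) has_vector_derivative f' u) (at 0)"
proof -
  obtain f' where f': "(f has_derivative f') (at x within U)"
    using assms by (auto simp: differentiable_on_def differentiable_def)
  show thesis
    by (rule that[of f'])
      (use has_vector_derivative_line[OF f' assms(2)] has_derivative_linear[OF f'] in
        \<open>auto simp: dir_deriv_def vector_derivative_at\<close>)
qed

lemma has_vector_derivative_dir_deriv:
  assumes "f differentiable_on U" "x \<in> U" "u \<in> W"
  shows "((\<lambda>s. f (x + s *\<^sub>R u)) has_vector_derivative dir_deriv u f x) (at 0)"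
  using dir_deriv_linear[OF assms(1,2)] assms(3) by metis

lemma eventually_line:
  assumes "x \<in> U" "u \<in> W"
  shows "\<forall>\<^sub>F s in nhds 0. x + s *\<^sub>R u \<in> U"
proof -
  obtain T where T: "open T" "U = W \<inter> T"
    using openin_U by (auto simp: openin_open)
  have "((\<lambda>s. x + s *\<^sub>R u) \<longlongrightarrow> x + 0 *\<^sub>R u) (nhds 0)"
    by (intro tendsto_intros filterlim_ident)
  then have "\<forall>\<^sub>F s in nhds 0. x + s *\<^sub>R u \<in> T"
    using T assms by (intro topological_tendstoD) auto
  then show ?thesis
    by eventually_elim (use T assms U_subset W_add W_scale in auto)
qed

end

lemma smooth_fun_on_differentiable: "smooth_fun_on W U f \<Longrightarrow> f differentiable_on U"
  unfolding smooth_fun_on_def using times_diff_on.simps(2) by blast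

lemma affine_connection_in:
  "\<lbrakk>affine_connection W U nabla; smooth_field W U X; smooth_field W U Y; x \<in> U\<rbrakk> \<Longrightarrow> nabla X Y x \<in> W"
  by (simp add: affine_connection_def)

lemma metric_compatibleD:
  "\<lbrakk>metric_compatible W U g nabla; smooth_field W U X; smooth_field W U Y; smooth_field W U Z; x \<in> U\<rbrakk> \<Longrightarrow>
    dir_deriv (X x) (\<lambda>z. g z (Y z) (Z z)) x = g x (nabla X Y x) (Z x) + g x (Y x) (nabla X Z x)"
  by (simp add: metric_compatible_def)

lemma torsion_freeD:
  "\<lbrakk>torsion_free W U nabla; smooth_field W U X; smooth_field W U Y; x \<in> U\<rbrakk> \<Longrightarrow>
    nabla X Y x - nabla Y X x = lie_bracket X Y x"
  by (simp add: torsion_free_def)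

lemma smooth_fun_on_const: "smooth_fun_on W U (\<lambda>_. k)"
proof -
  have "times_diff_on n W U (\<lambda>_. k)" for n
  proof (induction n arbitrary: k)
    case (Suc n)
    have "dir_deriv w (\<lambda>_. k) = (\<lambda>_. 0)" for w :: 'a
      by (simp add: dir_deriv_def fun_eq_iff)
    then show ?case using Suc by simp
  qed simp
  then show ?thesis by (simp add: smooth_fun_on_def)
qed

context subspace_metric
begin

lemma smooth_field_const: "k \<in> W \<Longrightarrow> smooth_field W U (\<lambda>_. k)"
  by (simp add: smooth_field_def smooth_fun_on_const)

lemma smooth_field_differentiable: "smooth_field W U X \<Longrightarrow> X differentiable_on U"
  by (auto simp: smooth_field_def intro: smooth_fun_on_differentiable)

lemma smooth_field_in: "smooth_field W U X \<Longrightarrow> x \<in> U \<Longrightarrow> X x \<in> W"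
  by (simp add: smooth_field_def)

section \<open>Linear algebra of the metric at a point\<close>

lemma g_add_right: "\<lbrakk>x \<in> U; u \<in> W; v \<in> W; w \<in> W\<rbrakk> \<Longrightarrow> g x w (u + v) = g x w u + g x w v"
  using g_add g_sym W_add by metis

lemma g_scale_right: "\<lbrakk>x \<in> U; u \<in> W; w \<in> W\<rbrakk> \<Longrightarrow> g x w (r *\<^sub>R u) = r * g x w u"
  using g_scale g_sym W_scale by metis

lemma g_diff_left: "\<lbrakk>x \<in> U; u \<in> W; v \<in> W; w \<in> W\<rbrakk> \<Longrightarrow> g x (u - v) w = g x u w - g x v w"
  using g_add[of x u "(-1) *\<^sub>R v" w] g_scale[of x v w "-1"] W_scale[of v "-1"] by simp

lemma g_zero_left: "\<lbrakk>x \<in> U; w \<in> W\<rbrakk> \<Longrightarrow> g x 0 w = 0"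
  using g_scale[of x 0 w 0] W_zero by simp

lemma g_eqI:
  assumes "x \<in> U" "u \<in> W" "v \<in> W" "\<And>w. w \<in> W \<Longrightarrow> g x u w = g x v w"
  shows "u = v"
proof (rule ccontr)
  assume "u \<noteq> v"
  then have "0 < g x (u - v) (u - v)"
    using assms W_diff by (intro g_pos) auto
  then show False
    using assms W_diff by (simp add: g_diff_left)
qed

lemma projection:
  obtains P where "linear P" "\<And>v. P v \<in> W" "\<And>v. v \<in> W \<Longrightarrow> P v = v"
proof -
  obtain P :: "'a \<Rightarrow> 'a" where "P ` UNIV \<subseteq> W" "linear P" "\<forall>v\<in>W. P (id v) = v"
    using linear_exists_left_inverse_on[OF linear_id subspace_W] by auto
  then show thesis by (intro that[of P]) auto
qed

text \<open>The form \<open>g x\<close> on \<open>W\<close> is extended by the Euclidean product of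
  the components \<open>v - P v\<close> to a positive definite form \<open>h\<close> on the whole
  space. Its Gram map \<open>G\<close> is injective, hence surjective; a preimage of the
  coefficients of \<open>\<phi>\<close> composed with \<open>P\<close> is then projected back to
  \<open>W\<close>.\<close>

lemma riesz:
  assumes x: "x \<in> U"
    and add: "\<And>u v. \<lbrakk>u \<in> W; v \<in> W\<rbrakk> \<Longrightarrow> \<phi> (u + v) = \<phi> u + \<phi> v"
    and scale: "\<And>r u. u \<in> W \<Longrightarrow> \<phi> (r *\<^sub>R u) = r * \<phi> u"
  shows "\<exists>v\<in>W. \<forall>w\<in>W. g x v w = \<phi> w"
proof -
  obtain P where P: "linear P" "\<And>v. P v \<in> W" "\<And>v. v \<in> W \<Longrightarrow> P v = v"
    using projection by blast
  note Padd = linear_add[OF P(1)] and Pscale = linear_cmul[OF P(1)]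
  define h where "h v w = g x (P v) (P w) + (v - P v) \<bullet> (w - P w)" for v w
  have h: "h v (a + b) = h v a + h v b" "h v (r *\<^sub>R a) = r * h v a" "h v w = h w v" for v a b r w
    using x P g_sym[OF x]
    by (auto simp: h_def Padd Pscale g_add_right g_scale_right algebra_simps inner_diff_left inner_diff_right
        inner_add_left inner_add_right inner_commute)
  have h_left: "h (a + b) v = h a v + h b v" "h (r *\<^sub>R a) v = r * h a v" for v a b r
    using h by metis+
  define G where "G v = (\<Sum>b\<in>Basis. h v b *\<^sub>R b)" for v
  have rep: "(\<Sum>b\<in>Basis. f b *\<^sub>R b) \<bullet> w = f w"
    if "\<And>a b. f (a + b) = f a + f b" "\<And>r a. f (r *\<^sub>R a) = r * f a" for f :: "'a \<Rightarrow> real" and w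
  proof -
    have "linear f" using that by (intro linearI) auto
    then have "f (\<Sum>b\<in>Basis. (w \<bullet> b) *\<^sub>R b) = (\<Sum>b\<in>Basis. (w \<bullet> b) * f b)"
      by (simp add: linear_sum linear_cmul)
    then have "f w = (\<Sum>b\<in>Basis. (w \<bullet> b) * f b)"
      by (simp add: euclidean_representation)
    then show ?thesis
      by (simp add: inner_sum_left inner_commute[of w] mult.commute)
  qed
  have Gh: "G v \<bullet> w = h v w" for v w
    unfolding G_def by (rule rep) (auto simp: h(1,2))
  have "linear G"
    by (intro linearI) (simp_all add: G_def h_left sum.distrib scaleR_add_left scaleR_sum_right)
  moreover have "v = 0" if "G v = 0" for v
  proof -
    have "h v v = 0" using Gh[of v v] that by simp
    moreover have "0 \<le> g x (P v) (P v)"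
      using g_pos[OF x P(2)] g_zero_left[OF x W_zero] by (metis less_eq_real_def)
    ultimately have *: "g x (P v) (P v) = 0" "(v - P v) \<bullet> (v - P v) = 0"
      using inner_ge_zero[of "v - P v"] unfolding h_def by linarith+
    then show ?thesis
      using g_pos[OF x P(2), of v] by force
  qed
  ultimately have "surj G"
    by (intro linear_injective_imp_surjective) (auto simp: linear_injective_0)
  then obtain v where v: "G v = (\<Sum>b\<in>Basis. \<phi> (P b) *\<^sub>R b)"
    by (metis surjD)
  have "g x (P v) w = \<phi> w" if "w \<in> W" for w
  proof -
    have "h v w = \<phi> (P w)"
      unfolding Gh[symmetric] v by (rule rep) (auto simp: Padd Pscale P add scale)
    then show ?thesis using that P by (simp add: h_def)
  qed
  then show ?thesis using P(2) by blast
qed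

section \<open>Derivatives of the metric coefficients in constant directions\<close>

abbreviation dg :: "'a \<Rightarrow> 'a \<Rightarrow> 'a \<Rightarrow> 'a \<Rightarrow> real" where
  "dg x u v w \<equiv> dir_deriv u (\<lambda>z. g z v w) x"

lemma dg_deriv:
  assumes "x \<in> U" "u \<in> W" "v \<in> W" "w \<in> W"
  shows "((\<lambda>s. g (x + s *\<^sub>R u) v w) has_real_derivative dg x u v w) (at 0)"
  using has_vector_derivative_dir_deriv[OF g_diff] assms
  by (simp add: has_real_derivative_iff_has_vector_derivative)

lemma dir_deriv_eqI:
  assumes "((\<lambda>s. f (x + s *\<^sub>R u)) has_vector_derivative D) (at 0)"
  shows "dir_deriv u f x = D"
  using assms by (simp add: dir_deriv_def vector_derivative_at)

text \<open>The algebraic laws of \<open>g\<close> hold only at points of \<open>U\<close>; this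
  transfers them to derivatives, because a line in a direction of \<open>W\<close> stays in
  \<open>U\<close> near 0.\<close>

lemma dir_deriv_eq_on:
  assumes "x \<in> U" "u \<in> W" "\<And>z. z \<in> U \<Longrightarrow> f z = h z"
    and "((\<lambda>s. h (x + s *\<^sub>R u)) has_vector_derivative D) (at 0)"
  shows "dir_deriv u f x = D"
proof (rule dir_deriv_eqI)
  have "\<forall>\<^sub>F s in nhds 0. f (x + s *\<^sub>R u) = h (x + s *\<^sub>R u)"
    using eventually_line[OF assms(1,2)] by eventually_elim (use assms in auto)
  then show "((\<lambda>s. f (x + s *\<^sub>R u)) has_vector_derivative D) (at 0)"
    using assms(4) by (subst has_vector_derivative_cong_ev[of _ _ "\<lambda>s. h (x + s *\<^sub>R u)"])
       (use assms in auto)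
qed

lemma dg_sym: "\<lbrakk>x \<in> U; u \<in> W; v \<in> W; w \<in> W\<rbrakk> \<Longrightarrow> dg x u v w = dg x u w v"
  by (rule dir_deriv_eq_on[where h = "\<lambda>z. g z w v"])
    (auto simp: g_sym intro!: has_vector_derivative_dir_deriv g_diff)

lemma dg_add1: "\<lbrakk>x \<in> U; u \<in> W; u' \<in> W; v \<in> W; w \<in> W\<rbrakk> \<Longrightarrow> dg x (u + u') v w = dg x u v w + dg x u' v w"
  using dir_deriv_linear[OF g_diff[of v w], of x] by (metis W_add linear_add)

lemma dg_scale1: "\<lbrakk>x \<in> U; u \<in> W; v \<in> W; w \<in> W\<rbrakk> \<Longrightarrow> dg x (r *\<^sub>R u) v w = r * dg x u v w"
  using dir_deriv_linear[OF g_diff[of v w], of x] by (metis W_scale linear_cmul real_scaleR_def)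

lemma dg_add2: "\<lbrakk>x \<in> U; u \<in> W; v \<in> W; v' \<in> W; w \<in> W\<rbrakk> \<Longrightarrow> dg x u (v + v') w = dg x u v w + dg x u v' w"
  by (rule dir_deriv_eq_on[where h = "\<lambda>z. g z v w + g z v' w"])
    (auto simp: g_add intro!: has_vector_derivative_dir_deriv g_diff has_vector_derivative_add)

lemma dg_scale2: "\<lbrakk>x \<in> U; u \<in> W; v \<in> W; w \<in> W\<rbrakk> \<Longrightarrow> dg x u (r *\<^sub>R v) w = r * dg x u v w"
  by (rule dir_deriv_eq_on[where h = "\<lambda>z. r * g z v w"])
    (auto simp: g_scale intro!: has_vector_derivative_dir_deriv g_diff has_vector_derivative_mult_right)

lemma dg_add3: "\<lbrakk>x \<in> U; u \<in> W; v \<in> W; w \<in> W; w' \<in> W\<rbrakk> \<Longrightarrow> dg x u v (w + w') = dg x u v w + dg x u v w'"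
  using dg_add2 dg_sym W_add by metis

lemma dg_scale3: "\<lbrakk>x \<in> U; u \<in> W; v \<in> W; w \<in> W\<rbrakk> \<Longrightarrow> dg x u v (r *\<^sub>R w) = r * dg x u v w"
  using dg_scale2 dg_sym W_scale by metis

text \<open>On \<open>U\<close> the field equals \<open>P\<close> applied to itself, and the linear
  map \<open>P\<close> commutes with differentiation, so the derivative is fixed by
  \<open>P\<close>.\<close>

lemma dir_deriv_in:
  assumes x: "x \<in> U" and u: "u \<in> W"
    and Y: "Y differentiable_on U" "\<And>z. z \<in> U \<Longrightarrow> Y z \<in> W"
  shows "dir_deriv u Y x \<in> W"
proof -
  obtain P where P: "linear P" "\<And>v. P v \<in> W" "\<And>v. v \<in> W \<Longrightarrow> P v = v"
    using projection by blast
  have "dir_deriv u Y x = P (dir_deriv u Y x)"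
  proof (rule dir_deriv_eq_on[OF x u])
    show "Y z = P (Y z)" if "z \<in> U" for z using P Y that by simp
    show "((\<lambda>s. P (Y (x + s *\<^sub>R u))) has_vector_derivative P (dir_deriv u Y x)) (at 0)"
      by (rule bounded_linear.has_vector_derivative[OF P(1)[unfolded linear_conv_bounded_linear]])
        (rule has_vector_derivative_dir_deriv[OF Y(1) x u])
  qed
  then show ?thesis using P(2) by metis
qed

text \<open>Basis vectors need not lie in \<open>W\<close>, so each is replaced by its projection
  \<open>P b\<close>; the coefficients stay the ambient coordinates, since \<open>v = P v\<close> on
  \<open>W\<close>.\<close>

lemma bilinear_on_expand:
  fixes B :: "'a \<Rightarrow> 'a \<Rightarrow> real"
  assumes P: "linear P" "\<And>v. P v \<in> W" "\<And>v. v \<in> W \<Longrightarrow> P v = v"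
    and "\<And>u v w. \<lbrakk>u \<in> W; v \<in> W; w \<in> W\<rbrakk> \<Longrightarrow> B (u + v) w = B u w + B v w"
    and "\<And>r u w. \<lbrakk>u \<in> W; w \<in> W\<rbrakk> \<Longrightarrow> B (r *\<^sub>R u) w = r * B u w"
    and "\<And>u v w. \<lbrakk>u \<in> W; v \<in> W; w \<in> W\<rbrakk> \<Longrightarrow> B w (u + v) = B w u + B w v"
    and "\<And>r u w. \<lbrakk>u \<in> W; w \<in> W\<rbrakk> \<Longrightarrow> B w (r *\<^sub>R u) = r * B w u"
    and "v \<in> W" "w \<in> W"
  shows "B v w = (\<Sum>b\<in>Basis. \<Sum>b'\<in>Basis. (v \<bullet> b) * (w \<bullet> b') * B (P b) (P b'))"
proof -
  define F where "F v w = B (P v) (P w)" for v w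
  have F1: "linear (\<lambda>v. F v w)" and F2: "linear (F v)" for v w
    using assms by (auto intro!: linearI simp: F_def linear_add linear_cmul)
  have "F v w = F (\<Sum>b\<in>Basis. (v \<bullet> b) *\<^sub>R b) (\<Sum>b\<in>Basis. (w \<bullet> b) *\<^sub>R b)"
    by (simp add: euclidean_representation)
  also have "\<dots> = (\<Sum>b\<in>Basis. \<Sum>b'\<in>Basis. (v \<bullet> b) * ((w \<bullet> b') * F b b'))"
    by (simp add: linear_sum[OF F1] linear_cmul[OF F1] linear_sum[OF F2] linear_cmul[OF F2] sum_distrib_left)
      (subst sum.swap, simp add: mult.left_commute)
  finally show ?thesis
    using assms by (simp add: F_def mult.assoc)
qed

text \<open>Differentiability of \<open>g\<close> is available for constant arguments only.
  Expanding in the vectors \<open>P b\<close> moves the variation of \<open>Y\<close> and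
  \<open>Z\<close> into scalar coordinates, where the ordinary product rule applies
  termwise.\<close>

lemma dir_deriv_g:
  assumes x: "x \<in> U" and u: "u \<in> W"
    and Y: "Y differentiable_on U" "\<And>z. z \<in> U \<Longrightarrow> Y z \<in> W"
    and Z: "Z differentiable_on U" "\<And>z. z \<in> U \<Longrightarrow> Z z \<in> W"
  shows "dir_deriv u (\<lambda>z. g z (Y z) (Z z)) x
      = dg x u (Y x) (Z x) + g x (dir_deriv u Y x) (Z x) + g x (Y x) (dir_deriv u Z x)"
proof -
  obtain P where P: "linear P" "\<And>v. P v \<in> W" "\<And>v. v \<in> W \<Longrightarrow> P v = v"
    using projection by blast
  have gx: "g z v w = (\<Sum>b\<in>Basis. \<Sum>b'\<in>Basis. (v \<bullet> b) * (w \<bullet> b') * g z (P b) (P b'))"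
    if "z \<in> U" "v \<in> W" "w \<in> W" for z v w
    by (rule bilinear_on_expand[OF P]) (auto simp: g_add g_scale g_add_right g_scale_right that)
  have dgx: "dg x u v w = (\<Sum>b\<in>Basis. \<Sum>b'\<in>Basis. (v \<bullet> b) * (w \<bullet> b') * dg x u (P b) (P b'))"
    if "v \<in> W" "w \<in> W" for v w
    by (rule bilinear_on_expand[OF P]) (auto simp: dg_add2 dg_scale2 dg_add3 dg_scale3 that x u)
  have comp: "((\<lambda>s. f (x + s *\<^sub>R u) \<bullet> b) has_real_derivative dir_deriv u f x \<bullet> b) (at 0)"
    if "f differentiable_on U" for f :: "'a \<Rightarrow> 'a" and b
    unfolding has_real_derivative_iff_has_vector_derivative
    by (rule bounded_linear.has_vector_derivative[OF bounded_linear_inner_left])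
      (rule has_vector_derivative_dir_deriv[OF that x u])
  let ?Y = "dir_deriv u Y x" and ?Z = "dir_deriv u Z x"
  show ?thesis
  proof (rule dir_deriv_eq_on[OF x u])
    show "g z (Y z) (Z z) = (\<Sum>b\<in>Basis. \<Sum>b'\<in>Basis. (Y z \<bullet> b) * (Z z \<bullet> b') * g z (P b) (P b'))" if "z \<in> U" for z
      using that Y Z by (intro gx) auto
    have eq: "dg x u (Y x) (Z x) + g x ?Y (Z x) + g x (Y x) ?Z
      = (\<Sum>b\<in>Basis. \<Sum>b'\<in>Basis. ((?Y \<bullet> b) * (Z x \<bullet> b') + (?Z \<bullet> b') * (Y x \<bullet> b)) * g x (P b) (P b')
          + dg x u (P b) (P b') * ((Y x \<bullet> b) * (Z x \<bullet> b')))"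
      using x Y Z dir_deriv_in[OF x u Y] dir_deriv_in[OF x u Z]
      by (simp add: gx dgx sum.distrib[symmetric] algebra_simps)
    have "((\<lambda>s. \<Sum>b\<in>Basis. \<Sum>b'\<in>Basis. (Y (x + s *\<^sub>R u) \<bullet> b) * (Z (x + s *\<^sub>R u) \<bullet> b') * g (x + s *\<^sub>R u) (P b) (P b'))
      has_real_derivative dg x u (Y x) (Z x) + g x ?Y (Z x) + g x (Y x) ?Z) (at 0)"
      unfolding eq
      by (intro DERIV_sum DERIV_cong[OF DERIV_mult[OF DERIV_mult[OF comp[OF Y(1)] comp[OF Z(1)]] dg_deriv[OF x u P(2) P(2)]]]) simp
    then show "((\<lambda>s. \<Sum>b\<in>Basis. \<Sum>b'\<in>Basis. (Y (x + s *\<^sub>R u) \<bullet> b) * (Z (x + s *\<^sub>R u) \<bullet> b') * g (x + s *\<^sub>R u) (P b) (P b'))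
      has_vector_derivative dg x u (Y x) (Z x) + g x ?Y (Z x) + g x (Y x) ?Z) (at 0)"
      by (simp add: has_real_derivative_iff_has_vector_derivative)
  qed
qed

section \<open>Leibniz rules and closure of smooth fields under sums and multiples\<close>

lemma dir_deriv_add:
  assumes "x \<in> U" "u \<in> W" "f differentiable_on U" "h differentiable_on U"
  shows "dir_deriv u (\<lambda>z. f z + h z) x = dir_deriv u f x + dir_deriv u h x"
  using assms by (intro dir_deriv_eqI has_vector_derivative_add has_vector_derivative_dir_deriv)

lemma dir_deriv_scaleR:
  fixes f :: "'a \<Rightarrow> real" and h :: "'a \<Rightarrow> 'b::real_normed_vector"
  assumes "x \<in> U" "u \<in> W" "f differentiable_on U" "h differentiable_on U"
  shows "dir_deriv u (\<lambda>z. f z *\<^sub>R h z) x = dir_deriv u f x *\<^sub>R h x + f x *\<^sub>R dir_deriv u h x"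
proof (rule dir_deriv_eqI)
  have "((\<lambda>s. f (x + s *\<^sub>R u)) has_real_derivative dir_deriv u f x) (at 0)"
    using has_vector_derivative_dir_deriv[OF assms(3,1,2)]
    by (simp add: has_real_derivative_iff_has_vector_derivative)
  from has_vector_derivative_scaleR[OF this has_vector_derivative_dir_deriv[OF assms(4,1,2)]]
  show "((\<lambda>s. f (x + s *\<^sub>R u) *\<^sub>R h (x + s *\<^sub>R u)) has_vector_derivative
      dir_deriv u f x *\<^sub>R h x + f x *\<^sub>R dir_deriv u h x) (at 0)"
    by (simp add: add.commute)
qed

text \<open>The recursion in \<open>times_diff_on\<close> passes to \<open>dir_deriv w f\<close> as
  a total function, while the sum and product rules identify it only on \<open>U\<close>; this lets
  them be used inside the induction.\<close>

lemma times_diff_on_cong: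
  fixes f :: "'a \<Rightarrow> 'b::real_normed_vector"
  assumes "times_diff_on k W U f" "\<And>x. x \<in> U \<Longrightarrow> f x = h x"
  shows "times_diff_on k W U h"
  using assms
proof (induction k arbitrary: f h)
  case 0
  then show ?case by (simp cong: continuous_on_cong)
next
  case (Suc k)
  have "h differentiable_on U"
    using Suc.prems by (auto simp: differentiable_on_def intro: differentiable_transform_within[OF _ zero_less_one])
  moreover have "times_diff_on k W U (dir_deriv w h)" if w: "w \<in> W" for w
  proof (rule Suc.IH)
    show "times_diff_on k W U (dir_deriv w f)" using Suc.prems w by simp
    show "dir_deriv w f x = dir_deriv w h x" if "x \<in> U" for x
      by (rule dir_deriv_eq_on[OF that w Suc.prems(2)])
         (auto intro!: has_vector_derivative_dir_deriv that w \<open>h differentiable_on U\<close>)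
  qed
  ultimately show ?case by simp
qed

lemma times_diff_on_SucD: "times_diff_on (Suc k) W U f \<Longrightarrow> times_diff_on k W U f"
  by (induction k arbitrary: f) (auto simp: differentiable_imp_continuous_on)

lemma times_diff_on_add:
  assumes "times_diff_on k W U f" "times_diff_on k W U h"
  shows "times_diff_on k W U (\<lambda>z. f z + h z)"
  using assms
proof (induction k arbitrary: f h)
  case 0
  then show ?case by (simp add: continuous_on_add)
next
  case (Suc k)
  have "times_diff_on k W U (dir_deriv w (\<lambda>z. f z + h z))" if "w \<in> W" for w
    by (rule times_diff_on_cong[where f = "\<lambda>x. dir_deriv w f x + dir_deriv w h x"])
      (use Suc that in \<open>auto simp: dir_deriv_add\<close>)
  then show ?case using Suc.prems by (simp add: differentiable_on_add)
qed

lemma times_diff_on_scaleR: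
  fixes f :: "'a \<Rightarrow> real"
  assumes "times_diff_on k W U f" "times_diff_on k W U h"
  shows "times_diff_on k W U (\<lambda>z. f z *\<^sub>R h z)"
  using assms
proof (induction k arbitrary: f h)
  case 0
  then show ?case by (simp add: continuous_on_scaleR)
next
  case (Suc k)
  have "times_diff_on k W U (dir_deriv w (\<lambda>z. f z *\<^sub>R h z))" if w: "w \<in> W" for w
  proof (rule times_diff_on_cong[where f = "\<lambda>x. dir_deriv w f x *\<^sub>R h x + f x *\<^sub>R dir_deriv w h x"])
    show "times_diff_on k W U (\<lambda>x. dir_deriv w f x *\<^sub>R h x + f x *\<^sub>R dir_deriv w h x)"
      \<comment> \<open>Each product keeps one undifferentiated factor of order
        \<open>Suc k\<close>, which \<open>times_diff_on_SucD\<close> lowers to order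
        \<open>k\<close>.\<close>
      by (intro times_diff_on_add Suc.IH) (use Suc.prems w times_diff_on_SucD in auto)
  qed (use Suc.prems w in \<open>simp add: dir_deriv_scaleR\<close>)
  moreover have "(\<lambda>z. f z *\<^sub>R h z) differentiable_on U"
    using Suc.prems by (auto simp: differentiable_on_def)
  ultimately show ?case by simp
qed

lemma smooth_field_add:
  "smooth_field W U X \<Longrightarrow> smooth_field W U Y \<Longrightarrow> smooth_field W U (\<lambda>z. X z + Y z)"
  by (simp add: smooth_field_def smooth_fun_on_def times_diff_on_add W_add)

lemma smooth_field_scaleR:
  "smooth_fun_on W U f \<Longrightarrow> smooth_field W U X \<Longrightarrow> smooth_field W U (\<lambda>z. f z *\<^sub>R X z)"
  by (simp add: smooth_field_def smooth_fun_on_def times_diff_on_scaleR W_scale)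

section \<open>The Koszul formula, existence and uniqueness of the connection\<close>

definition christoffel :: "'a \<Rightarrow> 'a \<Rightarrow> 'a \<Rightarrow> 'a" where
  "christoffel x u v =
    (SOME z. z \<in> W \<and> (\<forall>w\<in>W. g x z w = (dg x u v w + dg x v u w - dg x w u v) / 2))"

text \<open>The right-hand side is the Koszul formula for constant fields, whose Lie brackets
  vanish. It is linear in \<open>w\<close>, so \<open>riesz\<close> supplies the vector.\<close>

lemma christoffel:
  assumes "x \<in> U" "u \<in> W" "v \<in> W"
  shows "christoffel x u v \<in> W"
    and "w \<in> W \<Longrightarrow> g x (christoffel x u v) w = (dg x u v w + dg x v u w - dg x w u v) / 2"
proof -
  have "\<exists>z\<in>W. \<forall>w\<in>W. g x z w = (dg x u v w + dg x v u w - dg x w u v) / 2"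
    by (rule riesz)
      (use assms in \<open>simp_all add: dg_add1 dg_add3 dg_scale1 dg_scale3 diff_divide_distrib add_divide_distrib algebra_simps\<close>)
  then have "\<exists>z. z \<in> W \<and> (\<forall>w\<in>W. g x z w = (dg x u v w + dg x v u w - dg x w u v) / 2)"
    by blast
  from someI_ex[OF this] show "christoffel x u v \<in> W"
    "w \<in> W \<Longrightarrow> g x (christoffel x u v) w = (dg x u v w + dg x v u w - dg x w u v) / 2"
    by (simp_all add: christoffel_def)
qed

lemma christoffel_sym: "\<lbrakk>x \<in> U; u \<in> W; v \<in> W\<rbrakk> \<Longrightarrow> christoffel x u v = christoffel x v u"
  by (rule g_eqI[of x]) (simp_all add: christoffel dg_sym)

lemma christoffel_add:
  "\<lbrakk>x \<in> U; u \<in> W; u' \<in> W; v \<in> W\<rbrakk> \<Longrightarrow> christoffel x (u + u') v = christoffel x u v + christoffel x u' v"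
  by (rule g_eqI[of x])
    (simp_all add: christoffel W_add g_add dg_add1 dg_add2 add_divide_distrib diff_divide_distrib)

lemma christoffel_scale:
  "\<lbrakk>x \<in> U; u \<in> W; v \<in> W\<rbrakk> \<Longrightarrow> christoffel x (r *\<^sub>R u) v = r *\<^sub>R christoffel x u v"
  by (rule g_eqI[of x])
    (simp_all add: christoffel W_scale g_scale dg_scale1 dg_scale2 right_diff_distrib distrib_left)

text \<open>In the sum of the two Koszul expressions the derivatives along \<open>v\<close> and
  \<open>w\<close> cancel, and the one along \<open>u\<close> appears twice.\<close>

lemma christoffel_compatible:
  "\<lbrakk>x \<in> U; u \<in> W; v \<in> W; w \<in> W\<rbrakk> \<Longrightarrow>
    g x (christoffel x u v) w + g x v (christoffel x u w) = dg x u v w"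
  by (simp add: g_sym[of x v] christoffel dg_sym[of x _ w v] field_simps)

text \<open>Flat derivative plus Christoffel term; the value 0 elsewhere matches the clause of
  \<open>levi_civita\<close> that fixes junk values.\<close>

definition koszul_connection :: "'a covariant_derivative" where
  "koszul_connection X Y x =
    (if smooth_field W U X \<and> smooth_field W U Y \<and> x \<in> U
     then dir_deriv (X x) Y x + christoffel x (X x) (Y x) else 0)"

lemma smooth_dir_deriv_in:
  "\<lbrakk>smooth_field W U Y; x \<in> U; u \<in> W\<rbrakk> \<Longrightarrow> dir_deriv u Y x \<in> W"
  by (rule dir_deriv_in) (auto intro: smooth_field_differentiable smooth_field_in)

lemma affine_connection_koszul: "affine_connection W U koszul_connection"
proof -
  have lin: "dir_deriv (u + v) Y x = dir_deriv u Y x + dir_deriv v Y x"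
    "dir_deriv (r *\<^sub>R u) Y x = r *\<^sub>R dir_deriv u Y x"
    if Y: "smooth_field W U Y" and x: "x \<in> U" and uv: "u \<in> W" "v \<in> W" for u v r Y x
  proof -
    obtain f' where f': "linear f'" "\<And>u. u \<in> W \<Longrightarrow> dir_deriv u Y x = f' u"
      using dir_deriv_linear[OF smooth_field_differentiable[OF Y] x] by metis
    show "dir_deriv (u + v) Y x = dir_deriv u Y x + dir_deriv v Y x"
      "dir_deriv (r *\<^sub>R u) Y x = r *\<^sub>R dir_deriv u Y x"
      using f' uv by (simp_all add: W_add W_scale linear_add linear_cmul)
  qed
  have right: "christoffel x u (v + v') = christoffel x u v + christoffel x u v'"
    "christoffel x u (r *\<^sub>R v) = r *\<^sub>R christoffel x u v"
    if "x \<in> U" "u \<in> W" "v \<in> W" "v' \<in> W" for x u v v' r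
    using that christoffel_sym christoffel_add christoffel_scale W_add W_scale by metis+
  show ?thesis
    unfolding affine_connection_def koszul_connection_def
    by (intro conjI allI impI ballI)
      \<comment> \<open>An uninstantiated variable in a premise would block rewriting; the instances
        at 0 reduce that premise to \<open>W_zero\<close>.\<close>
      (simp_all add: smooth_field_add smooth_field_scaleR smooth_field_in W_zero lin(1) lin(2)[where v = 0]
        right(1) right(2)[where v' = 0] christoffel(1)
        christoffel_add christoffel_scale W_add smooth_dir_deriv_in dir_deriv_add dir_deriv_scaleR
        smooth_field_differentiable smooth_fun_on_differentiable scaleR_add_right)
qed

lemma torsion_free_koszul: "torsion_free W U koszul_connection"
  by (auto simp: torsion_free_def koszul_connection_def lie_bracket_def smooth_field_in
      intro: christoffel_sym)

lemma metric_compatible_koszul: "metric_compatible W U g koszul_connection"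
  unfolding metric_compatible_def
proof (intro allI impI ballI)
  fix X Y Z x
  assume *: "smooth_field W U X" "smooth_field W U Y" "smooth_field W U Z" and x: "x \<in> U"
  note X = smooth_field_in[OF *(1) x] and Y = smooth_field_in[OF *(2)] and Z = smooth_field_in[OF *(3)]
  have "dir_deriv (X x) (\<lambda>z. g z (Y z) (Z z)) x
      = dg x (X x) (Y x) (Z x) + g x (dir_deriv (X x) Y x) (Z x) + g x (Y x) (dir_deriv (X x) Z x)"
    using * by (intro dir_deriv_g x X Y Z smooth_field_differentiable)
  then show "dir_deriv (X x) (\<lambda>z. g z (Y z) (Z z)) x
      = g x (koszul_connection X Y x) (Z x) + g x (Y x) (koszul_connection X Z x)"
    using * x X Y[OF x] Z[OF x] christoffel_compatible[OF x X Y[OF x] Z[OF x]]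
    by (simp add: koszul_connection_def g_add g_add_right smooth_dir_deriv_in christoffel(1))
qed

text \<open>The difference \<open>D\<close> of two such connections is symmetric and skew for \<open>g\<close>; permuting the
  three arguments of \<open>g (D X Y) Z\<close> cyclically twice turns it into its negative.\<close>

lemma levi_civita_eq: "levi_civita W U g = koszul_connection"
  unfolding levi_civita_def
proof (rule the_equality)
  fix nabla
  assume asm: "affine_connection W U nabla \<and> torsion_free W U nabla \<and> metric_compatible W U g nabla \<and>
    (\<forall>X Y x. \<not> (smooth_field W U X \<and> smooth_field W U Y \<and> x \<in> U) \<longrightarrow> nabla X Y x = 0)"
  note aff = asm[THEN conjunct1]
    and tor = asm[THEN conjunct2, THEN conjunct1]
    and comp = asm[THEN conjunct2, THEN conjunct2, THEN conjunct1]
    and junk = asm[THEN conjunct2, THEN conjunct2, THEN conjunct2]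
  have "nabla X Y x = koszul_connection X Y x" for X Y x
  proof (cases "smooth_field W U X \<and> smooth_field W U Y \<and> x \<in> U")
    case True
    define D where "D X Y = nabla X Y x - koszul_connection X Y x" for X Y
    have inW: "nabla X Y x \<in> W" "koszul_connection X Y x \<in> W"
      if "smooth_field W U X" "smooth_field W U Y" for X Y
      using affine_connection_in[OF aff that] affine_connection_in[OF affine_connection_koszul that] True
      by blast+
    then have DW: "D X Y \<in> W" if "smooth_field W U X" "smooth_field W U Y" for X Y
      using that by (simp add: D_def W_diff)
    have D_sym: "D X Y = D Y X" if "smooth_field W U X" "smooth_field W U Y" for X Y
    proof -
      have "nabla X Y x - nabla Y X x = koszul_connection X Y x - koszul_connection Y X x"
        using torsion_freeD[OF tor that] torsion_freeD[OF torsion_free_koszul that] True by metis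
      then show ?thesis by (simp add: D_def algebra_simps)
    qed
    have D_skew: "g x (D X Y) (Z x) = - g x (D X Z) (Y x)"
      if "smooth_field W U X" "smooth_field W U Y" "smooth_field W U Z" for X Y Z
    proof -
      have "g x (nabla X Y x) (Z x) + g x (Y x) (nabla X Z x)
          = g x (koszul_connection X Y x) (Z x) + g x (Y x) (koszul_connection X Z x)"
        using metric_compatibleD[OF comp that] metric_compatibleD[OF metric_compatible_koszul that] True by metis
      then show ?thesis
        using True that
        by (simp add: D_def g_diff_left inW smooth_field_in g_sym[of x "Y x"])
    qed
    have "g x (D X Y) w = g x 0 w" if w: "w \<in> W" for w
    proof -
      \<comment> \<open>\<open>D\<close> acts on fields, so the test vector is extended to a
        constant field before skewness and symmetry are applied.\<close>
      let ?Z = "\<lambda>_. w"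
      note sm = True[THEN conjunct1] True[THEN conjunct2, THEN conjunct1] smooth_field_const[OF w]
      have "g x (D X Y) w = - g x (D ?Z X) (Y x)"
        using D_skew[of X Y ?Z] D_sym[of X ?Z] sm by simp
      also have "\<dots> = g x (D Y ?Z) (X x)"
        using D_skew[of ?Z X Y] D_sym[of Y ?Z] sm by simp
      also have "\<dots> = - g x (D X Y) w"
        using D_skew[of Y ?Z X] D_sym[of X Y] sm by simp
      finally show ?thesis
        using True w by (simp add: g_zero_left)
    qed
    then have "D X Y = 0"
      using True by (intro g_eqI[of x]) (auto intro: DW W_zero)
    then show ?thesis by (simp add: D_def)
  next
    case False
    then show ?thesis using junk by (auto simp: koszul_connection_def)
  qed
  then show "nabla = koszul_connection" by blast
qed (auto simp: affine_connection_koszul torsion_free_koszul metric_compatible_koszul koszul_connection_def)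

lemma levi_civita_const:
  assumes "x \<in> U" "u \<in> W" "v \<in> W"
  shows "levi_civita W U g (\<lambda>_. u) (\<lambda>_. v) x = christoffel x u v"
  using assms by (simp add: levi_civita_eq koszul_connection_def smooth_field_const dir_deriv_def)

end

section \<open>The Cholesky-Vinberg path of a unipotent matrix\<close>

definition matpow :: "real^'n^'n \<Rightarrow> nat \<Rightarrow> real^'n^'n" where
  "matpow A k = ((\<lambda>B. A ** B) ^^ k) (mat 1)"

lemma matpow_simps [simp]: "matpow A 0 = mat 1" "matpow A (Suc k) = A ** matpow A k"
  by (simp_all add: matpow_def)

lemma matpow_entry_bound:
  fixes A :: "real^'n^'n"
  assumes "\<And>i j. \<bar>A$i$j\<bar> \<le> M"
  shows "\<bar>matpow A k $i$j\<bar> \<le> (real CARD('n) * M) ^ k"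
proof (induction k arbitrary: i j)
  case 0
  then show ?case by (simp add: mat_def)
next
  case (Suc k)
  have "0 \<le> M" using assms by (rule order_trans[OF abs_ge_zero])
  have "\<bar>matpow A (Suc k) $i$j\<bar> \<le> (\<Sum>l\<in>UNIV. \<bar>A$i$l * matpow A k $l$j\<bar>)"
    by (simp add: matrix_matrix_mult_def sum_abs)
  also have "\<dots> \<le> (\<Sum>l\<in>(UNIV::'n set). M * (real CARD('n) * M) ^ k)"
    unfolding abs_mult by (intro sum_mono mult_mono assms Suc.IH \<open>0 \<le> M\<close>) simp
  finally show ?case by simp
qed

text \<open>\<open>matrix_exp\<close> is a bare infinite sum, so convergence must come first. Each
  multiplication enlarges entries by a factor of at most \<open>n * M\<close>, which gives a
  comparison with the exponential series of \<open>n * M\<close>.\<close>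

lemma matrix_exp_sums:
  fixes A :: "real^'n^'n"
  shows "(\<lambda>k. (1 / fact k) *\<^sub>R matpow A k) sums matrix_exp A"
proof -
  define M where "M = (\<Sum>i\<in>UNIV. \<Sum>j\<in>UNIV. \<bar>A$i$j\<bar>)"
  define n where "n = real CARD('n)"
  have "\<bar>A$i$j\<bar> \<le> M" for i j
  proof -
    have "\<bar>A$i$j\<bar> \<le> (\<Sum>j\<in>UNIV. \<bar>A$i$j\<bar>)"
      by (rule member_le_sum) auto
    also have "\<dots> \<le> M"
      unfolding M_def by (rule member_le_sum[where f = "\<lambda>i. \<Sum>j\<in>UNIV. \<bar>A$i$j\<bar>"]) (auto intro: sum_nonneg)
    finally show ?thesis .
  qed
  note bound = matpow_entry_bound[OF this, folded n_def]
  have norm_bound: "norm (matpow A k) \<le> n * (n * (n * M) ^ k)" for k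
  proof -
    have "norm (matpow A k) \<le> (\<Sum>i\<in>UNIV. norm (matpow A k $ i))"
      unfolding norm_vec_def by (rule L2_set_le_sum) simp
    also have "\<dots> \<le> (\<Sum>i\<in>(UNIV::'n set). n * (n * M) ^ k)"
    proof (rule sum_mono)
      fix i :: 'n
      have "norm (matpow A k $ i) \<le> (\<Sum>j\<in>UNIV. \<bar>matpow A k $i$j\<bar>)"
        by (rule norm_le_l1_cart)
      also have "\<dots> \<le> (\<Sum>j\<in>(UNIV::'n set). (n * M) ^ k)"
        by (intro sum_mono bound)
      finally show "norm (matpow A k $ i) \<le> n * (n * M) ^ k"
        by (simp add: n_def)
    qed
    finally show ?thesis by (simp add: n_def)
  qed
  have "summable (\<lambda>k. (1 / fact k) *\<^sub>R matpow A k)"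
  proof (rule summable_comparison_test[OF exI, OF allI, OF impI])
    show "norm ((1 / fact k) *\<^sub>R matpow A k) \<le> n * n * ((n * M) ^ k /\<^sub>R fact k)" for k
      using norm_bound[of k] by (simp add: field_simps)
    show "summable (\<lambda>k. n * n * ((n * M) ^ k /\<^sub>R fact k))"
      by (intro summable_mult summable_exp_generic)
  qed
  then show ?thesis
    unfolding matrix_exp_def matpow_def by (rule summable_sums)
qed

lemma matrix_exp_entry_sums: "(\<lambda>k. matpow A k $i$j / fact k) sums (matrix_exp A $i$j)"
  using bounded_linear.sums[OF bounded_linear_vec_nth bounded_linear.sums[OF bounded_linear_vec_nth matrix_exp_sums]]
  by simp

lemma matpow_commute: "matpow A k ** A = A ** matpow A k"
  by (induction k) (simp_all add: matrix_mul_assoc[symmetric])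

text \<open>Entrywise, both products are sums of the same series, as \<open>A\<close> commutes with
  its powers. Thus any logarithm commutes with the matrix it is a logarithm of.\<close>

lemma matrix_exp_commute: "A ** matrix_exp A = matrix_exp A ** A"
proof -
  have "(A ** matrix_exp A)$i$j = (matrix_exp A ** A)$i$j" for i j
  proof (rule sums_unique2)
    let ?s = "\<lambda>k. (A ** matpow A k)$i$j / fact k"
    have "(\<lambda>k. \<Sum>l\<in>UNIV. A$i$l * (matpow A k $l$j / fact k)) sums (\<Sum>l\<in>UNIV. A$i$l * matrix_exp A $l$j)"
      by (intro sums_sum sums_mult matrix_exp_entry_sums)
    then show "?s sums (A ** matrix_exp A)$i$j"
      by (simp add: matrix_matrix_mult_def sum_divide_distrib)
    have "(\<lambda>k. \<Sum>l\<in>UNIV. (matpow A k $i$l / fact k) * A$l$j) sums (\<Sum>l\<in>UNIV. matrix_exp A $i$l * A$l$j)"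
      by (intro sums_sum sums_mult2 matrix_exp_entry_sums)
    then show "?s sums (matrix_exp A ** A)$i$j"
      unfolding matpow_commute[symmetric] by (simp add: matrix_matrix_mult_def sum_divide_distrib)
  qed
  then show ?thesis by (simp add: vec_eq_iff)
qed

lemma matrix_exp_nilpotent:
  assumes "matpow A n = 0"
  shows "matrix_exp A = (\<Sum>k<n. (1 / fact k) *\<^sub>R matpow A k)"
proof (rule sums_unique2[OF matrix_exp_sums])
  have "matpow A (n + m) = 0" for m
    by (induction m) (simp_all add: assms vec_eq_iff matrix_matrix_mult_def)
  then have "matpow A k = 0" if "k \<notin> {..<n}" for k
    using that by (metis le_Suc_ex lessThan_iff not_less)
  then show "(\<lambda>k. (1 / fact k) *\<^sub>R matpow A k) sums (\<Sum>k<n. (1 / fact k) *\<^sub>R matpow A k)"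
    by (intro sums_finite) auto
qed

lemma matrix_exp_lower_triangular_diag:
  fixes L :: "real^3^3"
  assumes "L$1$2 = 0" "L$1$3 = 0" "L$2$3 = 0"
  shows "matrix_exp L $i$i = exp (L$i$i)"
proof (rule sums_unique2[OF matrix_exp_entry_sums])
  have "matpow L k $1$2 = 0 \<and> matpow L k $1$3 = 0 \<and> matpow L k $2$3 = 0 \<and> (\<forall>i. matpow L k $i$i = (L$i$i) ^ k)" for k
    by (induction k) (simp_all add: assms mat_def matrix_matrix_mult_def sum_3 forall_3)
  then show "(\<lambda>k. matpow L k $i$i / fact k) sums exp (L$i$i)"
    using exp_converges[of "L$i$i"] by (simp add: divide_inverse mult.commute)
qed

section \<open>Logarithm and powers in the nilpotent direction\<close>

definition E31 :: "real^3^3" where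
  "E31 = vector [vector [0, 0, 0], vector [0, 0, 0], vector [1, 0, 0]]"

lemma E31_nth [simp]:
  "E31$1$1 = 0" "E31$1$2 = 0" "E31$1$3 = 0"
  "E31$2$1 = 0" "E31$2$2 = 0" "E31$2$3 = 0"
  "E31$3$1 = 1" "E31$3$2 = 0" "E31$3$3 = 0"
  by (simp_all add: E31_def vector_3)

lemma matrix_exp_E31: "matrix_exp (t *\<^sub>R E31) = mat 1 + t *\<^sub>R E31"
proof -
  have "matpow (t *\<^sub>R E31) 2 = 0"
    by (simp add: eval_nat_numeral vec_eq_iff forall_3 matrix_matrix_mult_def sum_3)
  from matrix_exp_nilpotent[OF this] show ?thesis
    by (simp add: eval_nat_numeral)
qed

text \<open>\<open>L\<close> commutes with \<open>mat 1 + E31\<close>, hence with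
  \<open>E31\<close>, which forces it to be lower triangular. Its diagonal exponentiates to 1 and so
  vanishes; then the cube of \<open>L\<close> is 0, the series stops at the quadratic term, and
  entries can be compared.\<close>

lemma matrix_exp_eq_E31:
  assumes "matrix_exp L = mat 1 + E31"
  shows "L = E31"
proof -
  have "L ** (mat 1 + E31) = (mat 1 + E31) ** L"
    using matrix_exp_commute[of L] assms by simp
  then have z: "L$1$2 = 0" "L$1$3 = 0" "L$2$3 = 0"
    by (simp_all add: vec_eq_iff forall_3 matrix_matrix_mult_def sum_3 mat_def)
  have "exp (L$i$i) = (mat 1 + E31)$i$i" for i
    using matrix_exp_lower_triangular_diag[OF z, of i] assms by simp
  from this[of 1] this[of 2] this[of 3] have d: "L$1$1 = 0" "L$2$2 = 0" "L$3$3 = 0"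
    by (simp_all add: mat_def)
  have "matpow L 3 = 0"
    by (simp add: eval_nat_numeral vec_eq_iff forall_3 matrix_matrix_mult_def sum_3 mat_def z d)
  from matrix_exp_nilpotent[OF this]
  have "mat 1 + L + (1/2) *\<^sub>R (L ** L) = mat 1 + E31"
    by (simp add: eval_nat_numeral assms)
  then show ?thesis
    by (auto simp: vec_eq_iff forall_3 matrix_matrix_mult_def sum_3 mat_def z d)
qed

lemma matrix_log_E31: "matrix_log (mat 1 + E31) = E31"
  unfolding matrix_log_def
proof (rule the_equality)
  have "z = 0" if "complex_eigenvalue E31 z" for z
    using that
    by (auto simp: complex_eigenvalue_def vec_eq_iff forall_3 matrix_vector_mult_def sum_3 map_matrix_def)
  then have "\<bar>Im z\<bar> < pi" if "complex_eigenvalue E31 z" for z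
    using that by force
  then show "matrix_exp E31 = mat 1 + E31 \<and> (\<forall>z. complex_eigenvalue E31 z \<longrightarrow> \<bar>Im z\<bar> < pi)"
    using matrix_exp_E31[of 1] by auto
qed (simp add: matrix_exp_eq_E31)

lemma matrix_rpow_E31: "matrix_rpow (mat 1 + E31) t = mat 1 + t *\<^sub>R E31"
  by (simp add: matrix_rpow_def matrix_log_E31 matrix_exp_E31)

text \<open>Entries are recovered in order: the first two diagonal ones by positive square roots,
  the last row by division, the corner by a final square root. This evaluates \<open>chol\<close> at
  endpoints given in the form \<open>\<Phi> T\<close>.\<close>

lemma inj_on_\<Phi>: "inj_on \<Phi> Hgrp"
proof (rule inj_onI)
  fix S T :: "real^3^3"
  assume S: "S \<in> Hgrp" and T: "T \<in> Hgrp" and eq: "\<Phi> S = \<Phi> T"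
  note zero = S[unfolded Hgrp_def mem_Collect_eq] T[unfolded Hgrp_def mem_Collect_eq]
  have pos: "0 < S$i$i" "0 < T$i$i" for i using zero by auto
  have e: "(S$1$1)\<^sup>2 = (T$1$1)\<^sup>2" "(S$2$2)\<^sup>2 = (T$2$2)\<^sup>2"
    "S$1$1 * S$3$1 = T$1$1 * T$3$1" "S$2$2 * S$3$2 = T$2$2 * T$3$2"
    "(S$3$1)\<^sup>2 + (S$3$2)\<^sup>2 + (S$3$3)\<^sup>2 = (T$3$1)\<^sup>2 + (T$3$2)\<^sup>2 + (T$3$3)\<^sup>2"
    using eq zero
    by (simp_all add: \<Phi>_def vec_eq_iff forall_3 matrix_matrix_mult_def transpose_def sum_3 power2_eq_square)
  have d: "S$1$1 = T$1$1" "S$2$2 = T$2$2"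
    using e(1,2) pos by (auto intro: power2_eq_imp_eq less_imp_le)
  have f: "S$3$1 = T$3$1" "S$3$2 = T$3$2"
    using e(3,4) pos(2)[of 1] pos(2)[of 2] by (auto simp: d)
  have "S$3$3 = T$3$3"
    using e(5) pos by (auto simp: f intro: power2_eq_imp_eq less_imp_le)
  then show "S = T"
    using d f zero by (simp add: vec_eq_iff forall_3)
qed

lemma chol_\<Phi>: "T \<in> Hgrp \<Longrightarrow> chol (\<Phi> T) = T"
  by (simp add: chol_def the_inv_into_f_f inj_on_\<Phi>)

lemma one_Hgrp: "mat 1 \<in> Hgrp"
  by (simp add: Hgrp_def mat_def)

lemma one_add_E31_Hgrp: "mat 1 + E31 \<in> Hgrp"
  by (simp add: Hgrp_def mat_def forall_3)

lemma cv_path_E31: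
  "cv_path (\<Phi> (mat 1)) (\<Phi> (mat 1 + E31)) t
    = mat 1 + t *\<^sub>R (E31 + transpose E31) + t\<^sup>2 *\<^sub>R (E31 ** transpose E31)"
proof -
  have "matrix_inv (mat 1) = (mat 1 :: real^3^3)"
    using someI[of "\<lambda>B. mat 1 ** B = mat 1 \<and> B ** mat 1 = mat 1" "mat 1 :: real^3^3"]
    by (simp add: matrix_inv_def)
  then show ?thesis
    by (simp add: cv_path_def chol_\<Phi> one_Hgrp one_add_E31_Hgrp matrix_rpow_E31)
      (simp add: \<Phi>_def vec_eq_iff forall_3 matrix_matrix_mult_def transpose_def sum_3 mat_def power2_eq_square)
qed

section \<open>The canonical metric in Schur complement coordinates\<close>

lemma subspace_Vsp: "subspace Vsp"
  by (auto simp: subspace_def Vsp_def transpose_def vec_eq_iff)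

text \<open>
  Up to a constant, \<open>ln (char_fun c x) = - 3/2 ln (x$1$1) - 3/2 ln (x$2$2) - 2 ln (schur x)\<close>, and \<open>g_schur\<close>
  is the Hessian of the right-hand side; its last summand comes from the second derivative of \<open>schur\<close>.
\<close>

definition schur :: "real^3^3 \<Rightarrow> real" where
  "schur x = x$3$3 - (x$1$3)\<^sup>2 / x$1$1 - (x$2$3)\<^sup>2 / x$2$2"

text \<open>The differential of \<open>schur\<close> at \<open>x\<close> in the direction
  \<open>u\<close>.\<close>

definition dschur :: "real^3^3 \<Rightarrow> real^3^3 \<Rightarrow> real" where
  "dschur x u = u$3$3 - 2 * (x$1$3 / x$1$1) * u$1$3 + (x$1$3 / x$1$1)\<^sup>2 * u$1$1
    - 2 * (x$2$3 / x$2$2) * u$2$3 + (x$2$3 / x$2$2)\<^sup>2 * u$2$2"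

definition g_schur :: "real^3^3 \<Rightarrow> real^3^3 \<Rightarrow> real^3^3 \<Rightarrow> real" where
  "g_schur x u v =
    3/2 * (u$1$1 * v$1$1 / (x$1$1)\<^sup>2 + u$2$2 * v$2$2 / (x$2$2)\<^sup>2)
    + 2 * dschur x u * dschur x v / (schur x)\<^sup>2
    + 4 / schur x *
      ((u$1$3 - x$1$3 / x$1$1 * u$1$1) * (v$1$3 - x$1$3 / x$1$1 * v$1$1) / x$1$1
       + (u$2$3 - x$2$3 / x$2$2 * u$2$2) * (v$2$3 - x$2$3 / x$2$2 * v$2$2) / x$2$2)"

lemma detV_schur: "0 < x$1$1 \<Longrightarrow> 0 < x$2$2 \<Longrightarrow> detV x = x$1$1 * x$2$2 * schur x"
  by (simp add: detV_def schur_def field_simps power2_eq_square)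

lemma schur_pos:
  assumes "x \<in> \<Omega>"
  shows "0 < schur x"
proof -
  have "0 < x$1$1 * x$2$2 * schur x"
    using \<Omega>_pos[OF assms] det_V assms detV_schur by (auto simp: \<Omega>_def)
  then show ?thesis
    by (rule zero_less_mult_pos) (simp add: \<Omega>_pos[OF assms])
qed

text \<open>Completing squares diagonalises the quadratic form with coefficients
  \<open>x$1$1\<close>, \<open>x$2$2\<close> and \<open>schur x\<close>. Finitely many strict
  inequalities then give relative openness.\<close>

lemma \<Omega>_eq: "\<Omega> = Vsp \<inter> {x. 0 < x$1$1 \<and> 0 < x$2$2 \<and> 0 < detV x}"
proof (intro equalityI subsetI)
  fix x assume "x \<in> \<Omega>"
  then show "x \<in> Vsp \<inter> {x. 0 < x$1$1 \<and> 0 < x$2$2 \<and> 0 < detV x}"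
    using \<Omega>_pos[of x] det_V[of x] by (auto simp: \<Omega>_def)
next
  fix x assume "x \<in> Vsp \<inter> {x. 0 < x$1$1 \<and> 0 < x$2$2 \<and> 0 < detV x}"
  then have x: "x \<in> Vsp" and pos: "0 < x$1$1" "0 < x$2$2" and "0 < detV x" by auto
  then have "0 < x$1$1 * x$2$2 * schur x"
    by (simp add: detV_schur)
  then have s: "0 < schur x"
    by (rule zero_less_mult_pos) (simp add: pos)
  have "0 < v \<bullet> (x *v v)" if "v \<noteq> 0" for v
  proof -
    let ?a = "v$1 + x$1$3 / x$1$1 * v$3" and ?b = "v$2 + x$2$3 / x$2$2 * v$3"
    have eq: "v \<bullet> (x *v v) = x$1$1 * ?a\<^sup>2 + x$2$2 * ?b\<^sup>2 + schur x * (v$3)\<^sup>2"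
      using pos
      by (simp add: inner_vec_def sum_3 matrix_vector_mult_def V_entries[OF x] schur_def
          field_simps power2_eq_square)
    have nn: "0 \<le> x$1$1 * ?a\<^sup>2" "0 \<le> x$2$2 * ?b\<^sup>2" "0 \<le> schur x * (v$3)\<^sup>2"
      using pos s by auto
    have "?a \<noteq> 0 \<or> ?b \<noteq> 0 \<or> v$3 \<noteq> 0"
      using that by (auto simp: vec_eq_iff forall_3)
    then have "0 < x$1$1 * ?a\<^sup>2 \<or> 0 < x$2$2 * ?b\<^sup>2 \<or> 0 < schur x * (v$3)\<^sup>2"
      using pos s by auto
    then show ?thesis
      using nn unfolding eq by linarith
  qed
  then show "x \<in> \<Omega>"
    using x by (simp add: \<Omega>_def)
qed

lemma openin_\<Omega>: "openin (top_of_set Vsp) \<Omega>"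
  unfolding \<Omega>_eq detV_def
  by (intro openin_open_Int open_Collect_conj open_Collect_less continuous_intros)

lemma g_can_schur:
  assumes c: "0 < c" and x: "x \<in> \<Omega>" and u: "u \<in> Vsp" and v: "v \<in> Vsp"
  shows "g_can c x u v = g_schur x u v"
proof -
  note pos = \<Omega>_pos[OF x] and s = schur_pos[OF x]
  have xV: "x \<in> Vsp" using x by (simp add: \<Omega>_def)
  \<comment> \<open>In these coordinates \<open>x\<close> is polynomial and the determinant is the
    monomial \<open>a * b * r\<close>, so the identities below need no division.\<close>
  define a b p q r where "a = x$1$1" "b = x$2$2" "p = x$1$3 / a" "q = x$2$3 / b" "r = schur x"
  have ab: "0 < a" "0 < b" "0 < r"
    using pos s by (simp_all add: a_b_p_q_r_def)
  have e: "x$1$1 = a" "x$2$2 = b" "x$1$3 = a * p" "x$2$3 = b * q" "x$3$3 = r + a * p\<^sup>2 + b * q\<^sup>2"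
    using ab by (simp_all add: a_b_p_q_r_def schur_def power2_eq_square)
  define tu tv where "tu = dschur x u" "tv = dschur x v"
  have t: "tw = w$3$3 - 2 * p * w$1$3 + p\<^sup>2 * w$1$1 - 2 * q * w$2$3 + q\<^sup>2 * w$2$2"
    if "tw = dschur x w" for w tw
    using that ab by (simp add: dschur_def e)
  have D: "detV x = a * b * r"
    using detV_schur pos by (simp add: a_b_p_q_r_def)
  have D1: "detV1 u x = u$1$1 * b * r + a * u$2$2 * r + a * b * tu"
    "detV1 v x = v$1$1 * b * r + a * v$2$2 * r + a * b * tv"
    unfolding detV1_def e t[OF tu_tv_def(1)] t[OF tu_tv_def(2)] by algebra+
  define m where "m = (u$1$3 - p * u$1$1) * (v$1$3 - p * v$1$1)"
  define n where "n = (u$2$3 - q * u$2$2) * (v$2$3 - q * v$2$2)"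
  \<comment> \<open>This is the product rule for \<open>a * b * r\<close>; the terms in
    \<open>m\<close> and \<open>n\<close> are \<open>a * b\<close> times the second derivative of
    \<open>schur\<close>.\<close>
  have D2: "detV2 u v x = u$1$1 * v$2$2 * r + v$1$1 * u$2$2 * r + u$1$1 * b * tv + v$1$1 * b * tu
      + u$2$2 * a * tv + v$2$2 * a * tu - 2 * b * m - 2 * a * n"
    unfolding detV2_def e t[OF tu_tv_def(1)] t[OF tu_tv_def(2)] m_def n_def by algebra
  have "(k *\<^sub>R A) ** B = k *\<^sub>R (A ** B)" "A ** (k *\<^sub>R B) = k *\<^sub>R (A ** B)" "trace (k *\<^sub>R A) = k * trace A"
    for k and A B :: "real^3^3"
    by (simp_all add: vec_eq_iff matrix_matrix_mult_def trace_def sum_distrib_left mult_ac)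
  then have "trace (matrix_inv x ** u ** matrix_inv x ** v)
      = (detV1 u x * detV1 v x - detV x * detV2 u v x) / (detV x)\<^sup>2"
    using trace_adjV[OF xV u v]
    by (simp add: matrix_inv_V[OF xV pos(3)] power2_eq_square matrix_mul_assoc)
  then have "g_can c x u v = - 1/2 * (u$1$1 * v$1$1 / a\<^sup>2 + u$2$2 * v$2$2 / b\<^sup>2)
    + 2 * ((detV1 u x * detV1 v x - detV x * detV2 u v x) / (detV x)\<^sup>2)"
    by (simp add: g_can_eq[OF assms] e)
  also have "\<dots> = 3/2 * (u$1$1 * v$1$1 / a\<^sup>2 + u$2$2 * v$2$2 / b\<^sup>2)
      + 2 * tu * tv / r\<^sup>2 + 4 / r * (m / a + n / b)"
    unfolding D D1 D2 using ab by (simp add: field_simps power2_eq_square)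
  also have "\<dots> = g_schur x u v"
    using ab by (simp add: g_schur_def tu_tv_def m_def n_def e a_b_p_q_r_def(5)[symmetric])
  finally show ?thesis .
qed

text \<open>On the diagonal the form is a sum of squares with positive weights. If all vanish, then
  so do \<open>u$1$1\<close> and \<open>u$2$2\<close>, next \<open>u$1$3\<close> and
  \<open>u$2$3\<close>, and finally \<open>u$3$3\<close> through \<open>dschur\<close>.\<close>

lemma g_schur_pos:
  assumes x: "x \<in> \<Omega>" and u: "u \<in> Vsp" "u \<noteq> 0"
  shows "0 < g_schur x u u"
proof (rule ccontr)
  note pos = \<Omega>_pos[OF x] schur_pos[OF x]
  let ?a = "u$1$3 - x$1$3 / x$1$1 * u$1$1" and ?b = "u$2$3 - x$2$3 / x$2$2 * u$2$2"
  have eq: "g_schur x u u = 3/2 * (u$1$1 / x$1$1)\<^sup>2 + 3/2 * (u$2$2 / x$2$2)\<^sup>2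
      + 2 * (dschur x u / schur x)\<^sup>2 + 4 / schur x * (?a\<^sup>2 / x$1$1) + 4 / schur x * (?b\<^sup>2 / x$2$2)"
    by (simp add: g_schur_def power2_eq_square distrib_left)
  have nn: "0 \<le> (u$1$1 / x$1$1)\<^sup>2" "0 \<le> (u$2$2 / x$2$2)\<^sup>2" "0 \<le> (dschur x u / schur x)\<^sup>2"
    "0 \<le> 4 / schur x * (?a\<^sup>2 / x$1$1)" "0 \<le> 4 / schur x * (?b\<^sup>2 / x$2$2)"
    using pos by auto
  assume "\<not> 0 < g_schur x u u"
  then have "(u$1$1 / x$1$1)\<^sup>2 = 0" "(u$2$2 / x$2$2)\<^sup>2 = 0" "(dschur x u / schur x)\<^sup>2 = 0"
    "4 / schur x * (?a\<^sup>2 / x$1$1) = 0" "4 / schur x * (?b\<^sup>2 / x$2$2) = 0"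
    using nn unfolding eq by linarith+
  then have "u$1$1 = 0" "u$2$2 = 0" "dschur x u = 0" "u$1$3 = 0" "u$2$3 = 0"
    using pos by auto
  moreover from this have "u$3$3 = 0"
    by (simp add: dschur_def)
  ultimately have "u = 0"
    by (simp add: vec_eq_iff forall_3 V_entries[OF u(1)])
  then show False using u by simp
qed

lemma g_schur_differentiable: "(\<lambda>x. g_schur x u v) differentiable_on \<Omega>"
proof -
  have entry: "(\<lambda>x. x$i$j) differentiable (at x within \<Omega>)" for i j and x :: "real^3^3"
    by (intro bounded_linear_imp_differentiable bounded_linear_compose[OF bounded_linear_vec_nth bounded_linear_vec_nth])
  show ?thesis
    unfolding g_schur_def schur_def dschur_def differentiable_on_def
  proof
    fix x assume x: "x \<in> \<Omega>"
    have "x$3$3 - (x$1$3)\<^sup>2 / x$1$1 - (x$2$3)\<^sup>2 / x$2$2 \<noteq> 0" "x$1$1 \<noteq> 0" "x$2$2 \<noteq> 0"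
      using \<Omega>_pos[OF x] schur_pos[OF x] by (simp_all add: schur_def)
    then show "(\<lambda>x. 3/2 * (u$1$1 * v$1$1 / (x$1$1)\<^sup>2 + u$2$2 * v$2$2 / (x$2$2)\<^sup>2) +
      2 * (u$3$3 - 2 * (x$1$3 / x$1$1) * u$1$3 + (x$1$3 / x$1$1)\<^sup>2 * u$1$1
        - 2 * (x$2$3 / x$2$2) * u$2$3 + (x$2$3 / x$2$2)\<^sup>2 * u$2$2) *
      (v$3$3 - 2 * (x$1$3 / x$1$1) * v$1$3 + (x$1$3 / x$1$1)\<^sup>2 * v$1$1
        - 2 * (x$2$3 / x$2$2) * v$2$3 + (x$2$3 / x$2$2)\<^sup>2 * v$2$2) /
      (x$3$3 - (x$1$3)\<^sup>2 / x$1$1 - (x$2$3)\<^sup>2 / x$2$2)\<^sup>2 +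
      4 / (x$3$3 - (x$1$3)\<^sup>2 / x$1$1 - (x$2$3)\<^sup>2 / x$2$2) *
      ((u$1$3 - x$1$3 / x$1$1 * u$1$1) * (v$1$3 - x$1$3 / x$1$1 * v$1$1) / x$1$1
       + (u$2$3 - x$2$3 / x$2$2 * u$2$2) * (v$2$3 - x$2$3 / x$2$2 * v$2$2) / x$2$2))
      differentiable (at x within \<Omega>)"
      by (intro differentiable_add differentiable_diff differentiable_mult differentiable_divide
          differentiable_power differentiable_const entry) simp_all
  qed
qed

lemma dschur_add: "dschur x (u + v) = dschur x u + dschur x v"
  by (simp add: dschur_def algebra_simps add_divide_distrib)

lemma dschur_scale: "dschur x (r *\<^sub>R u) = r * dschur x u"
  by (simp add: dschur_def algebra_simps)

lemma g_schur_add: "g_schur x (u + v) w = g_schur x u w + g_schur x v w"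
  by (simp add: g_schur_def dschur_add algebra_simps add_divide_distrib diff_divide_distrib)

lemma g_schur_scale: "g_schur x (r *\<^sub>R u) w = r * g_schur x u w"
  by (simp add: g_schur_def dschur_scale algebra_simps add_divide_distrib diff_divide_distrib)

lemma g_schur_commute: "g_schur x u w = g_schur x w u"
  by (simp add: g_schur_def mult.commute mult.left_commute)

lemma subspace_metric_g_can:
  assumes "0 < c"
  shows "subspace_metric Vsp \<Omega> (g_can c)"
proof
  show "(\<lambda>z. g_can c z v w) differentiable_on \<Omega>" if "v \<in> Vsp" "w \<in> Vsp" for v w
    using g_schur_differentiable[of v w] that
    by (auto simp: differentiable_on_def g_can_schur[OF assms]
        intro: differentiable_transform_within[OF _ zero_less_one])
qed (simp_all add: subspace_Vsp openin_\<Omega> subspace_add[OF subspace_Vsp] subspace_scale[OF subspace_Vsp]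
    g_can_schur[OF assms] g_schur_pos g_schur_add g_schur_scale,
    rule g_schur_commute)

section \<open>The endpoints, the velocity and the failing equation\<close>

lemma \<Phi>_Hgrp:
  assumes "T \<in> Hgrp"
  shows "\<Phi> T \<in> \<Omega>"
proof -
  note zero = assms[unfolded Hgrp_def mem_Collect_eq]
  then have pos: "0 < T$i$i" for i by auto
  have e: "\<Phi> T$1$1 = (T$1$1)\<^sup>2" "\<Phi> T$2$2 = (T$2$2)\<^sup>2" "\<Phi> T$1$2 = 0" "\<Phi> T$2$1 = 0"
    "\<Phi> T$1$3 = T$1$1 * T$3$1" "\<Phi> T$2$3 = T$2$2 * T$3$2" "\<Phi> T$3$1 = T$1$1 * T$3$1" "\<Phi> T$3$2 = T$2$2 * T$3$2"
    "\<Phi> T$3$3 = (T$3$1)\<^sup>2 + (T$3$2)\<^sup>2 + (T$3$3)\<^sup>2"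
    using zero by (simp_all add: \<Phi>_def matrix_matrix_mult_def transpose_def sum_3 power2_eq_square)
  have "detV (\<Phi> T) = (T$1$1 * T$2$2 * T$3$3)\<^sup>2"
    by (simp add: detV_def e power2_eq_square algebra_simps)
  moreover have "T$i$i \<noteq> 0" for i using pos[of i] by simp
  moreover have "\<Phi> T \<in> Vsp"
    by (simp add: Vsp_def e transpose_def vec_eq_iff forall_3)
  ultimately show ?thesis
    by (simp add: \<Omega>_eq e)
qed

text \<open>Derivatives within the nondegenerate interval are unique also at its ends, so the
  one-sided value at 0 is the expected one.\<close>

lemma vector_derivative_quadratic:
  fixes a u w :: "'a::euclidean_space"
  assumes "t \<in> {0..1::real}"
  shows "vector_derivative (\<lambda>s. a + s *\<^sub>R u + s\<^sup>2 *\<^sub>R w) (at t within {0..1}) = u + (2 * t) *\<^sub>R w"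
proof (rule vector_derivative_within_closed_interval)
  show "((\<lambda>s. a + s *\<^sub>R u + s\<^sup>2 *\<^sub>R w) has_vector_derivative u + (2 * t) *\<^sub>R w) (at t within {0..1})"
    by (auto intro!: derivative_eq_intros)
qed (use assms in auto)

theorem theorem5p1:
  fixes c :: real
  assumes "0 < c"
  shows "\<exists>x\<in>\<Omega>. \<exists>y\<in>\<Omega>.
    \<not> satisfies_geodesic_equation (levi_civita Vsp \<Omega> (g_can c)) {0..1} (cv_path x y)"
proof (intro bexI notI)
  interpret subspace_metric Vsp \<Omega> "g_can c"
    using assms by (rule subspace_metric_g_can)
  define u where "u = E31 + transpose E31"
  define w where "w = E31 ** transpose E31"
  have u_nth: "u$1$1 = 0" "u$1$2 = 0" "u$1$3 = 1" "u$2$1 = 0" "u$2$2 = 0" "u$2$3 = 0" "u$3$3 = 0"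
    by (simp_all add: u_def transpose_def)
  have w_nth: "w$1$1 = 0" "w$1$2 = 0" "w$1$3 = 0" "w$2$1 = 0" "w$2$2 = 0" "w$2$3 = 0" "w$3$3 = 1"
    by (simp_all add: w_def transpose_def matrix_matrix_mult_def sum_3)
  have V: "u \<in> Vsp" "w \<in> Vsp"
    by (simp_all add: Vsp_def vec_eq_iff forall_3 u_def w_def transpose_def matrix_matrix_mult_def sum_3)
  have I: "mat 1 \<in> \<Omega>"
    using \<Phi>_Hgrp[OF one_Hgrp] by (simp add: \<Phi>_def)
  let ?\<gamma> = "cv_path (\<Phi> (mat 1)) (\<Phi> (mat 1 + E31))"
  have \<gamma>: "?\<gamma> = (\<lambda>t. mat 1 + t *\<^sub>R u + t\<^sup>2 *\<^sub>R w)"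
    by (simp add: cv_path_E31 u_def w_def fun_eq_iff)
  have vel: "vector_derivative ?\<gamma> (at t within {0..1}) = u + (2 * t) *\<^sub>R w" if "t \<in> {0..1}" for t
    unfolding \<gamma> using that by (rule vector_derivative_quadratic)
  have acc: "vector_derivative (\<lambda>s. vector_derivative ?\<gamma> (at s within {0..1})) (at 0 within {0..1}) = 2 *\<^sub>R w"
  proof (rule vector_derivative_within_closed_interval)
    have "((\<lambda>s. u + (2 * s) *\<^sub>R w) has_vector_derivative 2 *\<^sub>R w) (at 0 within {0..1})"
      by (auto intro!: derivative_eq_intros)
    then show "((\<lambda>s. vector_derivative ?\<gamma> (at s within {0..1})) has_vector_derivative 2 *\<^sub>R w) (at 0 within {0..1})"
      by (rule has_vector_derivative_transform[rotated 2]) (simp_all add: vel)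
  qed auto
  \<comment> \<open>Discharging this assumption instantiates the witnesses that \<open>bexI\<close>
    left schematic.\<close>
  assume "satisfies_geodesic_equation (levi_civita Vsp \<Omega> (g_can c)) {0..1} ?\<gamma>"
  then have "covariant_deriv_along (levi_civita Vsp \<Omega> (g_can c)) {0..1} ?\<gamma>
      (\<lambda>s. vector_derivative ?\<gamma> (at s within {0..1})) 0 = 0"
    unfolding satisfies_geodesic_equation_def by simp
  then have "2 *\<^sub>R w + christoffel (mat 1) u u = 0"
    using levi_civita_const[OF I V(1) V(1)]
    by (simp add: covariant_deriv_along_def acc vel) (simp add: \<gamma>)
  then have "christoffel (mat 1) u u = (-2) *\<^sub>R w"
    by (simp add: eq_neg_iff_add_eq_0 add.commute)
  then have "g_can c (mat 1) (christoffel (mat 1) u u) w = -2 * g_can c (mat 1) w w"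
    using g_scale[OF I V(2) V(2), of "-2"] by simp
  moreover have "g_can c (mat 1) w w = 2"
    unfolding g_can_schur[OF assms I V(2) V(2)]
    by (simp add: g_schur_def dschur_def schur_def w_nth mat_def)
  moreover have "dg (mat 1) u u w = -4"
  proof (rule dir_deriv_eq_on[OF I V(1)])
    show "g_can c z u w = g_schur z u w" if "z \<in> \<Omega>" for z
      by (rule g_can_schur[OF assms that V])
    \<comment> \<open>Along \<open>mat 1 + s *\<^sub>R u\<close> the Schur complement is
      \<open>1 - s\<^sup>2\<close>, and \<open>dschur\<close> is \<open>- 2 * s\<close> on
      \<open>u\<close> and 1 on \<open>w\<close>; only the middle summand of \<open>g_schur\<close>
      survives.\<close>
    have "((\<lambda>s. - 4 * s / (1 - s\<^sup>2)\<^sup>2) has_real_derivative -4) (at 0)"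
      by (auto intro!: derivative_eq_intros)
    then show "((\<lambda>s. g_schur (mat 1 + s *\<^sub>R u) u w) has_vector_derivative -4) (at 0)"
      by (simp add: has_real_derivative_iff_has_vector_derivative g_schur_def dschur_def schur_def
          u_nth w_nth mat_def)
  qed
  moreover have "dg (mat 1) w u u = -4"
  proof (rule dir_deriv_eq_on[OF I V(2)])
    show "g_can c z u u = g_schur z u u" if "z \<in> \<Omega>" for z
      by (rule g_can_schur[OF assms that V(1) V(1)])
    \<comment> \<open>Along \<open>mat 1 + s *\<^sub>R w\<close> the Schur complement is
      \<open>1 + s\<close> and \<open>dschur\<close> vanishes on \<open>u\<close>, leaving only the
      last summand of \<open>g_schur\<close>.\<close>
    have "((\<lambda>s. 4 / (1 + s)) has_real_derivative -4) (at 0)"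
      by (auto intro!: derivative_eq_intros)
    then show "((\<lambda>s. g_schur (mat 1 + s *\<^sub>R w) u u) has_vector_derivative -4) (at 0)"
      by (simp add: has_real_derivative_iff_has_vector_derivative g_schur_def dschur_def schur_def
          u_nth w_nth mat_def)
  qed
  \<comment> \<open>The Koszul formula yields \<open>(-4 - 4 + 4) / 2 = -2\<close>, while the
    geodesic equation would require \<open>-2 * 2 = -4\<close>.\<close>
  ultimately show False
    using christoffel(2)[OF I V(1) V(1) V(2)] by simp
qed (simp_all add: \<Phi>_Hgrp one_Hgrp one_add_E31_Hgrp)

end
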